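(* There exists no finite function $f:\mathbb R^+\to\mathbb R^+$ such that for each $\phi\in W^{1,3}(\mathbb S^3,\mathbb S^3)$ there exists a function $u\in W^{1,4}(B^4,\mathbb S^3)$ satisfying $$u=\phi\ \text{ on }\partial B^4\text{ in the sense of traces, and }\ \|\nabla u\|_{L^4(B^4)}\leq f\left(\|\nabla\phi\|_{L^3(\mathbb S^3)}\right).$$
   Context: $\mathbb R^+=[0,\infty)$; $B^4$ is the unit ball of $\mathbb R^4$ and $\mathbb S^3=\partial B^4$. Sobolev maps into $\mathbb S^3$ are maps into $\mathbb R^{4}$ of the given Sobolev class with values in $\mathbb S^3$ almost everywhere. *)

theory Defs
  imports "HOL-Analysis.Analysis"
begin

subsection \<open>Lebesgue spaces and smooth functions\<close>

definition Lp_space :: "real \<Rightarrow> 'a measure \<Rightarrow> ('a \<Rightarrow> 'b::euclidean_space) set" where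
  "Lp_space p M =
     {f. f \<in> borel_measurable M \<and> integrable M (\<lambda>x. norm (f x) powr p)}"

text \<open>Meaningful for members of \<^const>\<open>Lp_space\<close> only: the Bochner integral of a
  non-integrable function is 0.\<close>

definition Lp_norm :: "real \<Rightarrow> 'a measure \<Rightarrow> ('a \<Rightarrow> 'b::euclidean_space) \<Rightarrow> real" where
  "Lp_norm p M f = (LINT x|M. norm (f x) powr p) powr (1 / p)"

primrec times_differentiable ::
    "nat \<Rightarrow> ('a::real_normed_vector \<Rightarrow> 'b::real_normed_vector) \<Rightarrow> bool" where
  "times_differentiable 0 f = continuous_on UNIV f"
| "times_differentiable (Suc k) f =
     ((\<forall>x. f differentiable (at x)) \<and>
      (\<forall>v. times_differentiable k (\<lambda>x. frechet_derivative f (at x) v)))"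

definition smooth :: "('a::real_normed_vector \<Rightarrow> 'b::real_normed_vector) \<Rightarrow> bool" where
  "smooth f \<longleftrightarrow> (\<forall>k. times_differentiable k f)"

definition test_function :: "(real^'n) set \<Rightarrow> (real^'n \<Rightarrow> real) \<Rightarrow> bool" where
  "test_function \<Omega> \<psi> \<longleftrightarrow>
     smooth \<psi> \<and> compact (closure {x. \<psi> x \<noteq> 0}) \<and> closure {x. \<psi> x \<noteq> 0} \<subseteq> \<Omega>"


subsection \<open>Sobolev spaces on open sets\<close>

text \<open>Gradients are matrices whose \<open>i\<close>-th row is the gradient of the \<open>i\<close>-th component, as for
  \<^const>\<open>jacobian\<close>. The norm of the type \<^typ>\<open>real^'n^'m\<close> is the Frobenius norm.\<close>

definition is_weak_gradient ::
    "(real^'n) set \<Rightarrow> (real^'n \<Rightarrow> real^'m) \<Rightarrow> (real^'n \<Rightarrow> real^'n^'m) \<Rightarrow> bool" where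
  "is_weak_gradient \<Omega> u G \<longleftrightarrow>
     (\<forall>\<psi>. test_function \<Omega> \<psi> \<longrightarrow>
        (\<forall>i j. (LINT x|lebesgue_on \<Omega>. u x $ i * frechet_derivative \<psi> (at x) (axis j 1))
             = - (LINT x|lebesgue_on \<Omega>. G x $ i $ j * \<psi> x)))"

definition sobolev :: "real \<Rightarrow> (real^'n) set \<Rightarrow> (real^'n \<Rightarrow> real^'m) set" where
  "sobolev p \<Omega> =
     {u \<in> Lp_space p (lebesgue_on \<Omega>).
        \<exists>G \<in> Lp_space p (lebesgue_on \<Omega>). is_weak_gradient \<Omega> u G}"

text \<open>For \<open>u \<in> sobolev p \<Omega>\<close> the weak gradient is unique up to null sets, so that its
  \<open>L\<^sup>p\<close> norm does not depend on the choice.\<close>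

definition weak_gradient ::
    "real \<Rightarrow> (real^'n) set \<Rightarrow> (real^'n \<Rightarrow> real^'m) \<Rightarrow> real^'n \<Rightarrow> real^'n^'m" where
  "weak_gradient p \<Omega> u =
     (SOME G. G \<in> Lp_space p (lebesgue_on \<Omega>) \<and> is_weak_gradient \<Omega> u G)"


subsection \<open>Sobolev spaces on the unit sphere\<close>

text \<open>The surface measure of the unit sphere of \<open>\<real>\<^sup>n\<close>, as the cone measure
  \<open>A \<mapsto> n \<cdot> vol {t x | 0 < t < 1, x \<in> A}\<close>.\<close>

definition sphere_measure :: "(real^'n) measure" where
  "sphere_measure =
     scale_measure (of_nat CARD('n))
       (distr (restrict_space lborel (ball 0 1 - {0}))
              (restrict_space borel (sphere 0 1)) (\<lambda>x. x /\<^sub>R norm x))"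

text \<open>Smooth tangential vector fields on the sphere are represented by smooth extensions to the
  whole space; the divergence on the sphere is the trace of the derivative over the tangent space,
  i.e.\ the full trace minus the normal contribution, and is independent of the extension.\<close>

definition tangential_field :: "(real^'n \<Rightarrow> real^'n) \<Rightarrow> bool" where
  "tangential_field X \<longleftrightarrow> smooth X \<and> (\<forall>x \<in> sphere 0 1. X x \<bullet> x = 0)"

definition sphere_div :: "(real^'n \<Rightarrow> real^'n) \<Rightarrow> real^'n \<Rightarrow> real" where
  "sphere_div X x =
     (\<Sum>b\<in>Basis. frechet_derivative X (at x) b \<bullet> b) - frechet_derivative X (at x) x \<bullet> x"

definition is_sphere_gradient ::
    "(real^'n \<Rightarrow> real^'m) \<Rightarrow> (real^'n \<Rightarrow> real^'n^'m) \<Rightarrow> bool" where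
  "is_sphere_gradient \<phi> G \<longleftrightarrow>
     (AE x in sphere_measure. \<forall>i. G x $ i \<bullet> x = 0) \<and>
     (\<forall>X. tangential_field X \<longrightarrow>
        (\<forall>i. (LINT x|sphere_measure. \<phi> x $ i * sphere_div X x)
           = - (LINT x|sphere_measure. G x $ i \<bullet> X x)))"

definition sphere_sobolev :: "real \<Rightarrow> (real^'n \<Rightarrow> real^'m) set" where
  "sphere_sobolev p =
     {\<phi> \<in> Lp_space p sphere_measure.
        \<exists>G \<in> Lp_space p sphere_measure. is_sphere_gradient \<phi> G}"

definition sphere_gradient ::
    "real \<Rightarrow> (real^'n \<Rightarrow> real^'m) \<Rightarrow> real^'n \<Rightarrow> real^'n^'m" where
  "sphere_gradient p \<phi> = (SOME G. G \<in> Lp_space p sphere_measure \<and> is_sphere_gradient \<phi> G)"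


subsection \<open>Traces and sphere-valued maps\<close>

text \<open>The trace operator is the continuous extension to \<open>W\<^sup>1\<^sup>,\<^sup>p\<close> of the restriction to the unit
  sphere of functions smooth up to the boundary; its graph is the closure of the graph of the
  restriction.\<close>

definition has_trace :: "real \<Rightarrow> (real^'n \<Rightarrow> real^'m) \<Rightarrow> (real^'n \<Rightarrow> real^'m) \<Rightarrow> bool" where
  "has_trace p u \<phi> \<longleftrightarrow>
     u \<in> sobolev p (ball 0 1) \<and> \<phi> \<in> Lp_space p sphere_measure \<and>
     (\<exists>v :: nat \<Rightarrow> real^'n \<Rightarrow> real^'m.
        (\<forall>k. smooth (v k)) \<and>
        (\<lambda>k. Lp_norm p (lebesgue_on (ball 0 1)) (\<lambda>x. v k x - u x)) \<longlonglongrightarrow> 0 \<and>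
        (\<lambda>k. Lp_norm p (lebesgue_on (ball 0 1))
               (\<lambda>x. jacobian (v k) (at x) - weak_gradient p (ball 0 1) u x)) \<longlonglongrightarrow> 0 \<and>
        (\<lambda>k. Lp_norm p sphere_measure (\<lambda>x. v k x - \<phi> x)) \<longlonglongrightarrow> 0)"

definition sobolev_ball_sphere :: "real \<Rightarrow> (real^'n \<Rightarrow> real^'m) set" where
  "sobolev_ball_sphere p =
     {u \<in> sobolev p (ball 0 1). AE x in lebesgue_on (ball 0 1). u x \<in> sphere 0 1}"

definition sobolev_sphere_sphere :: "real \<Rightarrow> (real^'n \<Rightarrow> real^'m) set" where
  "sobolev_sphere_sphere p =
     {\<phi> \<in> sphere_sobolev p. AE x in sphere_measure. \<phi> x \<in> sphere 0 1}"

end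

theory Submission
  imports Defs
begin

text \<open>Already the identity of the sphere has no extension \<open>u\<close> in \<open>W\<^sup>1\<^sup>,\<^sup>4\<close> with values in the sphere,
  so no bound of any kind is possible. Let \<open>\<rho> \<ge> 0\<close> be the Jacobian determinant of a map \<open>R\<close> of
  \<open>\<real>\<^sup>4\<close> that is locally constant near the sphere, \<open>\<rho> \<noteq> 0\<close>. If \<open>y\<close> agrees with the identity outside
  the ball, then \<open>\<integral> \<rho>(y) det Dy = \<integral> \<rho>\<close> over the ball, since \<open>R \<circ> y\<close> and \<open>R\<close> agree outside the ball: for
  maps \<open>f\<close> and \<open>g\<close> agreeing outside a compact set \<open>K\<close>, the perturbations \<open>id + s (f - id)\<close> and
  \<open>id + s (g - id)\<close> are bijections with equal images of \<open>K\<close> for small \<open>s \<ge> 0\<close>, and the volumes of these images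
  are polynomials in \<open>s\<close>, which then agree at \<open>s = 1\<close> too.

  Let \<open>v\<^sub>k\<close> be smooth maps converging to \<open>u\<close> in \<open>W\<^sup>1\<^sup>,\<^sup>4\<close> and to the identity in \<open>L\<^sup>4\<close> of the sphere, and
  let \<open>y\<close> interpolate between \<open>v\<^sub>k\<close> and the identity on a collar of width \<open>d\<close> of the sphere. As \<open>k \<rightarrow> \<infinity>\<close>,
  the integrand away from the collar tends to 0 because \<open>\<rho>(u) = 0\<close>, while on the collar it is controlled by
  \<open>\<bar>Dv\<^sub>k\<bar>\<^sup>4\<close> and \<open>d\<^sup>-\<^sup>4 \<bar>v\<^sub>k - x\<bar>\<^sup>4\<close>, hence, by a Poincare inequality on the collar, by the integral
  of \<open>1 + \<bar>Du\<bar>\<^sup>4\<close> there, which tends to 0 with \<open>d\<close>. This contradicts \<open>\<integral> \<rho> > 0\<close>.\<close>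

subsection \<open>Integrals of Jacobian determinants\<close>

lemma norm_matrix_vector_mult_le:
  fixes A :: "real^'n^'m"
  shows "norm (A *v x) \<le> norm A * norm x"
proof -
  have "norm (A *v x) = L2_set (\<lambda>i. norm ((A *v x) $ i)) UNIV" by (simp add: norm_vec_def)
  also have "\<dots> \<le> L2_set (\<lambda>i. norm (A $ i) * norm x) UNIV"
    by (rule L2_set_mono) (auto simp: matrix_vector_mul_component Cauchy_Schwarz_ineq2)
  also have "\<dots> = norm A * norm x"
    by (simp add: norm_vec_def[of A] L2_set_left_distrib)
  finally show ?thesis .
qed

lemma abs_matrix_component_le_norm: "\<bar>A $ i $ j\<bar> \<le> norm A" for A :: "real^'n^'m"
  by (rule order_trans[OF component_le_norm_cart Finite_Cartesian_Product.norm_nth_le])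

text \<open>Leibniz expansion: one term per permutation, each a product of entries bounded by the
  norm. In dimension 4 this lets fourth powers of gradients control the integrands.\<close>

lemma abs_det_le:
  fixes A :: "real^'n^'n"
  shows "\<bar>det A\<bar> \<le> fact CARD('n) * norm A ^ CARD('n)"
proof -
  have "\<bar>det A\<bar> \<le> (\<Sum>p | p permutes (UNIV::'n set). \<bar>of_int (sign p) * (\<Prod>i\<in>UNIV. A $ i $ p i)\<bar>)"
    unfolding det_def by (rule sum_abs)
  also have "\<dots> \<le> (\<Sum>p | p permutes (UNIV::'n set). norm A ^ CARD('n))"
  proof (rule sum_mono)
    fix p :: "'n \<Rightarrow> 'n"
    have "\<bar>of_int (sign p) * (\<Prod>i\<in>UNIV. A $ i $ p i)\<bar> = (\<Prod>i\<in>UNIV. \<bar>A $ i $ p i\<bar>)"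
      by (simp add: abs_mult abs_prod sign_def)
    also have "\<dots> \<le> (\<Prod>i\<in>(UNIV::'n set). norm A)"
      by (intro prod_mono) (auto simp: abs_matrix_component_le_norm)
    finally show "\<bar>of_int (sign p) * (\<Prod>i\<in>UNIV. A $ i $ p i)\<bar> \<le> norm A ^ CARD('n)" by simp
  qed
  also have "\<dots> = fact CARD('n) * norm A ^ CARD('n)"
    by (simp add: card_permutations)
  finally show ?thesis .
qed

lemma continuous_on_det:
  fixes F :: "_ \<Rightarrow> real^'n^'n"
  assumes F: "continuous_on S F"
  shows "continuous_on S (\<lambda>x. det (F x))"
  unfolding det_def
  by (intro continuous_on_sum continuous_on_mult continuous_on_const continuous_on_prod
      continuous_on_component F)

lemma integrable_on_compact:
  fixes f :: "'a::euclidean_space \<Rightarrow> real"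
  assumes "compact K" "continuous_on K f"
  shows "f integrable_on K"
proof -
  have "set_integrable lborel K f"
    unfolding set_integrable_def by (rule borel_integrable_compact[OF assms])
  then show ?thesis by (rule set_borel_integral_eq_integral(1))
qed

text \<open>Each Leibniz product is multiplied out over the set \<open>X\<close> of rows taken from
  \<open>A\<close>; the remaining rows come from \<open>B\<close> and contribute the power of
  \<open>s\<close>.\<close>

lemma det_add_scaleR:
  fixes A B :: "real^'n^'n"
  shows "det (A + s *\<^sub>R B) = (\<Sum>p | p permutes UNIV. \<Sum>X\<in>Pow UNIV.
     s ^ card (UNIV - X) * (of_int (sign p) * ((\<Prod>i\<in>X. A $ i $ p i) * (\<Prod>i\<in>UNIV - X. B $ i $ p i))))"
  unfolding det_def
proof (intro sum.cong refl)
  fix p :: "'n \<Rightarrow> 'n"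
  show "of_int (sign p) * (\<Prod>i\<in>UNIV. (A + s *\<^sub>R B) $ i $ p i) = (\<Sum>X\<in>Pow UNIV.
     s ^ card (UNIV - X) * (of_int (sign p) * ((\<Prod>i\<in>X. A $ i $ p i) * (\<Prod>i\<in>UNIV - X. B $ i $ p i))))"
    by (simp add: prod_add prod.distrib sum_distrib_left algebra_simps)
qed

text \<open>Polynomial dependence on \<open>s\<close> replaces analytic continuation: an identity
  between two such integrals that holds for small \<open>s\<close> extends to
  \<open>s = 1\<close>.\<close>

lemma integral_det_add_scaleR_poly:
  fixes A B :: "real^'n \<Rightarrow> real^'n^'n"
  assumes K: "compact K" and A: "continuous_on K A" and B: "continuous_on K B"
  obtains P :: "real poly" where "\<And>s. integral K (\<lambda>x. det (A x + s *\<^sub>R B x)) = poly P s"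
proof
  let ?g = "\<lambda>p X x. of_int (sign p) * ((\<Prod>i\<in>X. A x $ i $ p i) * (\<Prod>i\<in>UNIV - X. B x $ i $ p i))"
  let ?P = "\<Sum>p | p permutes UNIV. \<Sum>X\<in>Pow UNIV. monom (integral K (?g p X)) (card (UNIV - X))"
  have int: "?g p X integrable_on K" for p X
    by (intro integrable_on_compact[OF K] continuous_on_mult continuous_on_const continuous_on_prod
        continuous_on_component A B)
  fix s
  have "integral K (\<lambda>x. det (A x + s *\<^sub>R B x))
      = (\<Sum>p | p permutes UNIV. \<Sum>X\<in>Pow UNIV. integral K (\<lambda>x. s ^ card (UNIV - X) * ?g p X x))"
    unfolding det_add_scaleR
    by (simp only: integral_sum integrable_sum integrable_on_mult_right int finite_permutations
        finite finite_Pow_iff)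
  also have "\<dots> = poly ?P s"
    by (simp only: integral_mult_right poly_sum poly_monom mult.commute)
  finally show "integral K (\<lambda>x. det (A x + s *\<^sub>R B x)) = poly ?P s" .
qed

text \<open>The identity plus a contraction: points with equal images would be at most half their
  distance apart, and a preimage of \<open>y\<close> is the fixed point of the contraction sending
  \<open>x\<close> to \<open>y - e x\<close>.\<close>

lemma bij_lipschitz_perturbation:
  fixes e :: "'a::banach \<Rightarrow> 'a"
  assumes e: "\<And>x y. norm (e x - e y) \<le> norm (x - y) / 2"
  shows "bij (\<lambda>x. x + e x)"
proof (rule bijI)
  show "inj (\<lambda>x. x + e x)"
  proof (rule injI)
    fix x y assume "x + e x = y + e y"
    then have "x - y = - (e x - e y)" by (simp add: algebra_simps)
    then have "norm (x - y) = norm (e x - e y)" by (simp only: norm_minus_cancel)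
    with e[of x y] show "x = y" by simp
  qed
  show "surj (\<lambda>x. x + e x)"
  proof (rule surjI)
    fix y
    have "\<exists>!x. y - e x = x"
      using e by (intro banach_fix_type[of "1/2"]) (auto simp: dist_norm norm_minus_commute)
    then have "y - e (THE x. y - e x = x) = (THE x. y - e x = x)" by (rule theI')
    then show "(THE x. y - e x = x) + e (THE x. y - e x = x) = y"
      by (metis diff_add_cancel)
  qed
qed

text \<open>The determinant cannot vanish on the segment starting at \<open>mat 1\<close>: a kernel
  vector would satisfy \<open>x = - t M x\<close> and so have at most half its own norm. The sign at
  \<open>t = 0\<close> persists.\<close>

lemma det_pos_perturbation:
  fixes M :: "real^'n^'n"
  assumes "norm M \<le> 1/2"
  shows "det (mat 1 + M) > 0"
proof (rule ccontr)
  assume "\<not> ?thesis"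
  moreover have "continuous_on {0..1} (\<lambda>t. det (mat 1 + t *\<^sub>R M))"
    by (intro continuous_on_det continuous_intros)
  ultimately obtain t where t: "0 \<le> t" "t \<le> 1" "det (mat 1 + t *\<^sub>R M) = 0"
    using IVT2'[of "\<lambda>t. det (mat 1 + t *\<^sub>R M)" 1 0 0] by (auto simp: not_less)
  then have "\<not> invertible (mat 1 + t *\<^sub>R M)" by (simp add: invertible_det_nz)
  then obtain x where x: "(mat 1 + t *\<^sub>R M) *v x = 0" "x \<noteq> 0"
    using matrix_left_invertible_ker invertible_left_inverse by blast
  then have "x = - (t *\<^sub>R (M *v x))"
    by (simp add: matrix_vector_mult_add_rdistrib scaleR_matrix_vector_assoc eq_neg_iff_add_eq_0)
  then have "norm x = t * norm (M *v x)" using t by (metis abs_of_nonneg norm_minus_cancel norm_scaleR)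
  also have "\<dots> \<le> 1 * (1/2 * norm x)"
    using t assms by (intro mult_mono order_trans[OF norm_matrix_vector_mult_le] mult_right_mono) auto
  finally show False using x by simp
qed

text \<open>This takes the place of homotopy invariance of the degree, with volumes of images
  instead of topology.\<close>

theorem integral_det_derivative_eq:
  fixes f g :: "real^'n::{finite,wellorder} \<Rightarrow> real^'n::_"
    and F G :: "real^'n::_ \<Rightarrow> real^'n::_^'n::_"
  assumes f: "\<And>x. (f has_derivative (*v) (F x)) (at x)"
    and g: "\<And>x. (g has_derivative (*v) (G x)) (at x)"
    and F: "continuous_on UNIV F" "\<And>x. norm (F x) \<le> b"
    and G: "continuous_on UNIV G" "\<And>x. norm (G x) \<le> b"
    and K: "compact K" and eq: "\<And>x. x \<notin> K \<Longrightarrow> f x = g x"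
  shows "integral K (\<lambda>x. det (F x)) = integral K (\<lambda>x. det (G x))"
proof -
  \<comment> \<open>\<open>c\<close> bounds the norm of \<open>H x - mat 1\<close>, so that for
    \<open>s \<le> 1 / (2 * c)\<close> the perturbation of the identity has Lipschitz constant
    1/2.\<close>
  define c where "c = b + norm (mat 1 :: real^'n::_^'n::_) + 1"
  have "b \<ge> 0" using F(2)[of 0] norm_ge_zero order_trans by blast
  then have c: "c > 0" unfolding c_def by (smt (verit) norm_ge_zero)
  have perturb: "bij (\<lambda>x. x + s *\<^sub>R (h x - x)) \<and>
      measure lebesgue ((\<lambda>x. x + s *\<^sub>R (h x - x)) ` K)
        = integral K (\<lambda>x. det (mat 1 + s *\<^sub>R (H x - mat 1)))"
    if h: "\<And>x. (h has_derivative (*v) (H x)) (at x)" and H: "continuous_on UNIV H" "\<And>x. norm (H x) \<le> b"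
      and s: "0 \<le> s" "s \<le> 1 / (2 * c)" for h H s
  proof
    have le: "norm (s *\<^sub>R (H x - mat 1)) \<le> 1/2" for x
    proof -
      have "norm (s *\<^sub>R (H x - mat 1)) = s * norm (H x - mat 1)" using s by simp
      also have "\<dots> \<le> 1 / (2 * c) * c"
        using s c H(2)[of x] unfolding c_def
        by (intro mult_mono order_trans[OF norm_triangle_ineq4]) auto
      finally show ?thesis using c by simp
    qed
    have der: "((\<lambda>x. s *\<^sub>R (h x - x)) has_derivative (*v) (s *\<^sub>R (H x - mat 1))) (at x)" for x
      by (auto intro!: derivative_eq_intros h
          simp: matrix_vector_mult_diff_rdistrib scaleR_matrix_vector_assoc[symmetric])
    show bij: "bij (\<lambda>x. x + s *\<^sub>R (h x - x))"
    proof (rule bij_lipschitz_perturbation)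
      fix x y
      have "norm ((s *\<^sub>R (H x - mat 1)) *v y) \<le> 1/2 * norm y" for x y
        by (rule order_trans[OF norm_matrix_vector_mult_le mult_right_mono[OF le norm_ge_zero]])
      then have "onorm ((*v) (s *\<^sub>R (H x - mat 1))) \<le> 1/2" for x
        by (rule onorm_bound[rotated]) simp
      then show "norm (s *\<^sub>R (h x - x) - s *\<^sub>R (h y - y)) \<le> norm (x - y) / 2"
        using differentiable_bound[of UNIV "\<lambda>x. s *\<^sub>R (h x - x)" "\<lambda>x. (*v) (s *\<^sub>R (H x - mat 1))" "1/2" x y]
          der by simp
    qed
    have "measure lebesgue ((\<lambda>x. x + s *\<^sub>R (h x - x)) ` K)
        = integral K (\<lambda>x. \<bar>det (matrix ((*v) (mat 1 + s *\<^sub>R (H x - mat 1))))\<bar>)"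
    proof (rule measure_differentiable_image_eq)
      show "K \<in> sets lebesgue" using K by (simp add: compact_imp_closed lmeasurable_compact fmeasurableD)
      show "((\<lambda>x. x + s *\<^sub>R (h x - x)) has_derivative (*v) (mat 1 + s *\<^sub>R (H x - mat 1))) (at x within K)" for x
        using has_derivative_add[OF has_derivative_ident has_derivative_at_withinI[OF der]]
        unfolding matrix_vector_mult_add_rdistrib[abs_def] by simp
      show "inj_on (\<lambda>x. x + s *\<^sub>R (h x - x)) K" using bij by (meson bij_is_inj inj_on_subset subset_UNIV)
      show "(\<lambda>x. \<bar>det (matrix ((*v) (mat 1 + s *\<^sub>R (H x - mat 1))))\<bar>) integrable_on K"
        by (intro integrable_on_compact K)
          (auto intro!: continuous_intros continuous_on_det continuous_on_subset[OF H(1)])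
    qed
    \<comment> \<open>Near the identity the determinant is positive, so the absolute value of the
      area formula disappears; with it the integral would not be polynomial in
      \<open>s\<close>.\<close>
    also have "\<dots> = integral K (\<lambda>x. det (mat 1 + s *\<^sub>R (H x - mat 1)))"
      using det_pos_perturbation[OF le] by (intro integral_cong) (simp add: abs_of_pos)
    finally show "measure lebesgue ((\<lambda>x. x + s *\<^sub>R (h x - x)) ` K)
        = integral K (\<lambda>x. det (mat 1 + s *\<^sub>R (H x - mat 1)))" .
  qed
  have F': "continuous_on K (\<lambda>x. F x - mat 1)" and G': "continuous_on K (\<lambda>x. G x - mat 1)"
    using F(1) G(1) by (auto intro!: continuous_intros intro: continuous_on_subset)
  obtain P where P: "\<And>s. integral K (\<lambda>x. det (mat 1 + s *\<^sub>R (F x - mat 1))) = poly P s"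
    using integral_det_add_scaleR_poly[OF K continuous_on_const[of K "mat 1"] F'] by blast
  obtain Q where Q: "\<And>s. integral K (\<lambda>x. det (mat 1 + s *\<^sub>R (G x - mat 1))) = poly Q s"
    using integral_det_add_scaleR_poly[OF K continuous_on_const[of K "mat 1"] G'] by blast
  have "poly P s = poly Q s" if s: "0 \<le> s" "s \<le> 1 / (2 * c)" for s
  proof -
    let ?f = "\<lambda>x. x + s *\<^sub>R (f x - x)" and ?g = "\<lambda>x. x + s *\<^sub>R (g x - x)"
    \<comment> \<open>The maps are comparable only off \<open>K\<close>; bijectivity turns equal
      images of the complement into equal images of \<open>K\<close>.\<close>
    have "?f ` (- K) = ?g ` (- K)" using eq by (intro image_cong) auto
    moreover have "?f ` K = - ?f ` (- K)" "?g ` K = - ?g ` (- K)"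
      using perturb[OF f F s] perturb[OF g G s] by (auto simp: bij_image_Compl_eq)
    ultimately have "?f ` K = ?g ` K" by simp
    then show ?thesis using perturb[OF f F s] perturb[OF g G s] P Q by metis
  qed
  \<comment> \<open>The difference polynomial has infinitely many roots. At \<open>s = 1\<close> the
    matrices are \<open>F x\<close> and \<open>G x\<close> themselves.\<close>
  then have "{0..1 / (2 * c)} \<subseteq> {s. poly (P - Q) s = 0}" by auto
  moreover have "infinite {0..1 / (2 * c)}" using c by (simp add: infinite_Icc_iff)
  ultimately have "infinite {s. poly (P - Q) s = 0}" using finite_subset by blast
  then have "P - Q = 0" using poly_roots_finite by blast
  then have "P = Q" by simp
  then show ?thesis using P[of 1] Q[of 1] by simp
qed

subsection \<open>A piecewise quadratic step function\<close>

text \<open>The hat function \<open>max 0 (1 - |s|)\<close>, written as a second difference of the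
  absolute value so that it can be integrated termwise using \<open>s * |s|\<close>.\<close>

definition tent :: "real \<Rightarrow> real" where
  "tent s = (\<bar>s + 1\<bar> - 2 * \<bar>s\<bar> + \<bar>s - 1\<bar>) / 2"

text \<open>The antiderivative of \<^term>\<open>tent\<close> that rises from 0 at \<open>-1\<close> to 1 at \<open>1\<close>.\<close>

definition ramp :: "real \<Rightarrow> real" where
  "ramp s = ((s + 1) * \<bar>s + 1\<bar> - 2 * (s * \<bar>s\<bar>) + (s - 1) * \<bar>s - 1\<bar> + 2) / 4"

lemma has_real_derivative_mult_abs: "((\<lambda>x::real. x * \<bar>x\<bar>) has_real_derivative 2 * \<bar>x\<bar>) (at x)"
proof (cases x "0::real" rule: linorder_cases)
  case equal
  have "((\<lambda>h::real. \<bar>h\<bar>) \<longlongrightarrow> 0) (at 0)" by (intro tendsto_eq_intros) auto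
  then have "((\<lambda>h::real. h * \<bar>h\<bar> / h) \<longlongrightarrow> 0) (at 0)"
    by (rule Lim_transform_eventually) (auto simp: eventually_at_filter)
  then show ?thesis using equal by (simp add: DERIV_def)
next
  case less
  have "((\<lambda>x::real. - x\<^sup>2) has_real_derivative 2 * \<bar>x\<bar>) (at x)"
    using less by (auto intro!: derivative_eq_intros)
  then show ?thesis
    by (rule has_field_derivative_transform_within_open[where S="{..<0}"])
       (use less in \<open>auto simp: power2_eq_square\<close>)
next
  case greater
  have "((\<lambda>x::real. x\<^sup>2) has_real_derivative 2 * \<bar>x\<bar>) (at x)"
    using greater by (auto intro!: derivative_eq_intros)
  then show ?thesis
    by (rule has_field_derivative_transform_within_open[where S="{0<..}"])
       (use greater in \<open>auto simp: power2_eq_square\<close>)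
qed

lemma has_real_derivative_ramp: "(ramp has_real_derivative tent s) (at s)"
proof -
  have "((\<lambda>s::real. (s + c) * \<bar>s + c\<bar>) has_real_derivative 2 * \<bar>s + c\<bar>) (at s)" for c
    using has_real_derivative_mult_abs[of "s + c"] by (simp add: DERIV_shift)
  from this[of 1] this[of "-1"] has_real_derivative_mult_abs[of s]
  have 1: "((\<lambda>s::real. (s + 1) * \<bar>s + 1\<bar>) has_real_derivative 2 * \<bar>s + 1\<bar>) (at s)"
    "((\<lambda>s::real. (s - 1) * \<bar>s - 1\<bar>) has_real_derivative 2 * \<bar>s - 1\<bar>) (at s)"
    "((\<lambda>s::real. s * \<bar>s\<bar>) has_real_derivative 2 * \<bar>s\<bar>) (at s)" by simp_all
  show ?thesis unfolding ramp_def[abs_def] tent_def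
    using DERIV_cdivide[OF DERIV_add[OF DERIV_add[OF
        DERIV_diff[OF 1(1) DERIV_cmult[OF 1(3), of 2]] 1(2)] DERIV_const[of 2]], of 4]
    by (rule DERIV_cong) (simp add: field_simps)
qed

lemma continuous_on_tent: "continuous_on S tent"
  unfolding tent_def[abs_def] by (intro continuous_intros) auto

lemma tent_nonneg: "0 \<le> tent s" and tent_le_1: "tent s \<le> 1" and tent_eq_0: "1 \<le> \<bar>s\<bar> \<Longrightarrow> tent s = 0"
  and tent_ge: "1 - \<bar>s\<bar> \<le> tent s"
  unfolding tent_def by auto

lemma ramp_eq_0: "s \<le> -1 \<Longrightarrow> ramp s = 0" and ramp_eq_1: "1 \<le> s \<Longrightarrow> ramp s = 1"
  unfolding ramp_def by (auto simp: abs_of_nonpos abs_of_nonneg algebra_simps)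

lemma ramp_mono: "s \<le> t \<Longrightarrow> ramp s \<le> ramp t"
  by (rule DERIV_nonneg_imp_nondecreasing) (auto intro: has_real_derivative_ramp tent_nonneg)

lemma ramp_nonneg: "0 \<le> ramp s" and ramp_le_1: "ramp s \<le> 1"
  \<comment> \<open>Monotonicity compares \<open>s\<close> with a point on the plateau 0 to its left
    and one on the plateau 1 to its right.\<close>
  using ramp_mono[of "min s (-1)" s] ramp_mono[of s "max s 1"] ramp_eq_0[of "min s (-1)"] ramp_eq_1[of "max s 1"]
  by auto

lemma continuous_on_ramp: "continuous_on S ramp"
  unfolding ramp_def[abs_def] by (intro continuous_intros) auto

subsection \<open>The divergence theorem on the sphere\<close>

lemma integrable_continuous_bounded_support:
  fixes f :: "'a::euclidean_space \<Rightarrow> real"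
  assumes "continuous_on UNIV f" "\<And>x. r < norm x \<Longrightarrow> f x = 0"
  shows "integrable lborel f"
proof -
  have "integrable lborel (\<lambda>x. indicator (cball 0 r) x *\<^sub>R f x)"
    by (intro borel_integrable_compact continuous_on_subset[OF assms(1)]) auto
  also have "(\<lambda>x. indicator (cball 0 r) x *\<^sub>R f x) = f"
    using assms(2) by (auto simp: indicator_def fun_eq_iff)
  finally show ?thesis .
qed

text \<open>By translation invariance the difference quotients in direction \<open>v\<close> have
  integral 0; they converge to the derivative, dominated by a constant on a ball.\<close>

lemma integral_directional_derivative_eq_0:
  fixes h :: "'a::euclidean_space \<Rightarrow> real"
  assumes h: "\<And>x. (h has_derivative h' x) (at x)"
    and cont: "continuous_on UNIV (\<lambda>x. h' x v)"
    and supp: "\<And>x. r < norm x \<Longrightarrow> h x = 0"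
  shows "(LINT x|lborel. h' x v) = 0"
proof -
  have h'0: "h' x v = 0" if "r < norm x" for x
  proof -
    have "open {x::'a. r < norm x}" by (intro open_Collect_less continuous_intros)
    then have "(h has_derivative (\<lambda>_. 0)) (at x)"
      using that supp
      by (intro has_derivative_transform_within_open[OF has_derivative_const, of "{x. r < norm x}"]) auto
    from has_derivative_unique[OF h this] show ?thesis by simp
  qed
  have hcont: "continuous_on UNIV h"
    using h by (meson continuous_on_eq_continuous_at has_derivative_continuous open_UNIV)
  \<comment> \<open>A shift by at most \<open>v\<close> moves the support by at most
    \<open>norm v\<close>, so this ball carries all the difference quotients.\<close>
  define C where "C = cball (0::'a) (r + norm v)"
  have "compact ((\<lambda>x. h' x v) ` C)"
    unfolding C_def by (intro compact_continuous_image continuous_on_subset[OF cont]) auto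
  then have "bounded ((\<lambda>x. h' x v) ` C)" by (rule compact_imp_bounded)
  then obtain b where b: "b > 0" "\<And>x. x \<in> C \<Longrightarrow> \<bar>h' x v\<bar> \<le> b"
    unfolding bounded_pos by auto
  have b': "\<bar>h' x v\<bar> \<le> b" for x
    using b(1) b(2)[of x] h'0[of x] norm_ge_zero[of v] unfolding C_def by (cases "r < norm x") (auto simp: not_less)
  define t where "t k = 1 / real (Suc k)" for k
  have t: "0 < t k" "t k \<le> 1" for k unfolding t_def by auto
  define s where "s k x = (h (x + t k *\<^sub>R v) - h x) / t k" for k x
  have line: "((\<lambda>u. h (x + u *\<^sub>R v)) has_real_derivative h' (x + u *\<^sub>R v) v) (at u)" for x u
  proof -
    have "((\<lambda>u. x + u *\<^sub>R v) has_derivative (\<lambda>d. d *\<^sub>R v)) (at u)"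
      by (auto intro!: derivative_eq_intros)
    from has_derivative_compose[OF this h]
    have "((\<lambda>u. h (x + u *\<^sub>R v)) has_derivative (\<lambda>d. h' (x + u *\<^sub>R v) (d *\<^sub>R v))) (at u)" .
    moreover have "(\<lambda>d. h' (x + u *\<^sub>R v) (d *\<^sub>R v)) = (*) (h' (x + u *\<^sub>R v) v)"
      using linear_cmul[OF has_derivative_linear[OF h]] by (auto simp: mult.commute)
    ultimately show ?thesis by (simp add: has_field_derivative_def)
  qed
  \<comment> \<open>The mean value theorem transfers the bound on the derivative to the difference
    quotients.\<close>
  have mv: "\<exists>y. s k x = h' y v" for k x
    using MVT2[OF t(1)[of k], of "\<lambda>u. h (x + u *\<^sub>R v)", OF line] t(1)[of k]
    unfolding s_def by (auto simp: field_simps)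
  have "(\<lambda>k. LINT x|lborel. s k x) \<longlonglongrightarrow> (LINT x|lborel. h' x v)"
  proof (rule integral_dominated_convergence[where w="\<lambda>x. b * indicator C x"])
    show "(\<lambda>x. h' x v) \<in> borel_measurable lborel"
      using borel_measurable_continuous_onI[OF cont] by simp
    show "s k \<in> borel_measurable lborel" for k
      unfolding s_def[abs_def] measurable_lborel2
      by (intro borel_measurable_continuous_onI continuous_intros continuous_on_compose2[OF hcont])
         (use t(1)[of k] in auto)
    show "integrable lborel (\<lambda>x. b * indicator C x)"
      unfolding C_def by (intro integrable_mult_right integrable_real_indicator) (use emeasure_compact_finite[OF compact_cball] in auto)
    show "AE x in lborel. (\<lambda>k. s k x) \<longlonglongrightarrow> h' x v"
    proof (rule AE_I2)
      fix x
      have "((\<lambda>e. (h (x + e *\<^sub>R v) - h x) / e) \<longlongrightarrow> h' x v) (at 0)"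
        using line[of x 0] by (simp add: DERIV_def)
      moreover have "filterlim t (at 0) sequentially"
        using LIMSEQ_inverse_real_of_nat
        by (auto simp: filterlim_at t_def[abs_def] inverse_eq_divide)
      ultimately show "(\<lambda>k. s k x) \<longlonglongrightarrow> h' x v"
        unfolding s_def[abs_def] by (rule filterlim_compose)
    qed
    show "AE x in lborel. norm (s k x) \<le> b * indicator C x" for k
    proof (rule AE_I2)
      fix x
      show "norm (s k x) \<le> b * indicator C x"
      proof (cases "x \<in> C")
        case True
        then show ?thesis using mv[of k x] b'[of] by auto
      next
        case False
        have "norm x - t k * norm v \<le> norm (x + t k *\<^sub>R v)"
          using norm_diff_ineq[of x "t k *\<^sub>R v"] t(1)[of k] by simp
        moreover have "t k * norm v \<le> norm v" using t[of k] by (simp add: mult_left_le_one_le)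
        ultimately have "r < norm x" "r < norm (x + t k *\<^sub>R v)"
          using False unfolding C_def by (auto intro: le_less_trans[of r "r + norm v"])
        then show ?thesis using supp False by (simp add: s_def)
      qed
    qed
  qed
  moreover have "(LINT x|lborel. s k x) = 0" for k
  proof -
    have hm: "h \<in> borel_measurable borel" using hcont by (rule borel_measurable_continuous_onI)
    have hi: "integrable lborel h"
      by (rule integrable_continuous_bounded_support[OF hcont supp])
    have "integrable (distr lborel borel ((+) (t k *\<^sub>R v))) h" 
      "(LINT x|distr lborel borel ((+) (t k *\<^sub>R v)). h x) = (LINT x|lborel. h x)"
      using hi by (simp_all add: lborel_distr_plus)
    then have "integrable lborel (\<lambda>x. h (x + t k *\<^sub>R v))"
      "(LINT x|lborel. h (x + t k *\<^sub>R v)) = (LINT x|lborel. h x)"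
      using hm by (simp_all add: integrable_distr_eq integral_distr add.commute)
    then show ?thesis using hi unfolding s_def by simp
  qed
  ultimately show ?thesis by (simp add: LIMSEQ_const_iff)
qed

section \<open>Integration against the surface measure\<close>

lemma measurable_sphere_projection:
  "(\<lambda>x::real^'n. x /\<^sub>R norm x) \<in>
     restrict_space lborel (ball 0 1 - {0}) \<rightarrow>\<^sub>M restrict_space borel (sphere 0 1)"
  by (intro measurable_restrict_space2) (auto simp: space_restrict_space intro!: measurable_restrict_space1)

text \<open>As a constant density, the scaling factor can be pulled into Bochner integrals.\<close>

lemma sphere_measure_density:
  "sphere_measure = density (distr (restrict_space lborel (ball 0 1 - {0}))
     (restrict_space borel (sphere 0 1)) (\<lambda>x::real^'n. x /\<^sub>R norm x)) (\<lambda>_. of_nat CARD('n))"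
  unfolding sphere_measure_def by (intro measure_eqI) (auto simp: emeasure_density_const)

lemma sets_sphere_measure: "sets sphere_measure = sets (restrict_space borel (sphere (0::real^'n) 1))"
  and space_sphere_measure: "space sphere_measure = sphere (0::real^'n) 1"
  unfolding sphere_measure_def by (auto simp: space_scale_measure space_restrict_space)

lemma finite_measure_sphere_measure: "finite_measure (sphere_measure :: (real^'n) measure)"
proof (rule finite_measureI)
  have "emeasure (sphere_measure :: (real^'n) measure) (space sphere_measure)
      \<le> of_nat CARD('n) * emeasure lborel (ball (0::real^'n) 1 - {0})"
    unfolding sphere_measure_def
    by (subst emeasure_scale_measure, subst emeasure_distr[OF measurable_sphere_projection])
      (auto simp: sets_restrict_space_iff space_scale_measure space_restrict_space emeasure_restrict_space
         intro!: mult_left_mono emeasure_mono)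
  also have "\<dots> < \<infinity>"
    using emeasure_bounded_finite[of "ball (0::real^'n) 1 - {0}"] bounded_subset[OF bounded_ball, of "ball (0::real^'n) 1 - {0}" 0 1]
    by (auto simp: ennreal_mult_less_top of_nat_less_top)
  finally show "emeasure (sphere_measure :: (real^'n) measure) (space sphere_measure) \<noteq> \<infinity>" by simp
qed

lemma borel_measurable_sphere_measure:
  fixes f :: "real^'n \<Rightarrow> 'b::topological_space"
  assumes "continuous_on (sphere 0 1) f"
  shows "f \<in> borel_measurable sphere_measure"
  using borel_measurable_continuous_on_restrict[OF assms]
  by (subst measurable_cong_sets[OF sets_sphere_measure refl])

lemma integrable_sphere_measure:
  fixes f :: "real^'n \<Rightarrow> 'b::{banach, second_countable_topology}"
  assumes f: "continuous_on (sphere 0 1) f"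
  shows "integrable sphere_measure f"
proof -
  have "bounded (f ` sphere 0 1)"
    by (intro compact_imp_bounded compact_continuous_image f) auto
  then obtain b where "\<And>x. x \<in> sphere 0 1 \<Longrightarrow> norm (f x) \<le> b"
    unfolding bounded_iff by blast
  then show ?thesis
    by (intro finite_measure.integrable_const_bound[OF finite_measure_sphere_measure, of _ b]
        borel_measurable_sphere_measure f AE_I2) (simp add: space_sphere_measure)
qed

text \<open>Surface integrals become volume integrals of the 0-homogeneous extension, to which
  calculus in the whole space applies.\<close>

lemma integral_sphere_measure:
  fixes f :: "real^'n \<Rightarrow> real"
  assumes f: "continuous_on (sphere 0 1) f"
  shows "(LINT x|sphere_measure. f x)
    = CARD('n) * (LINT x|lborel. indicator (ball 0 1 - {0}) x * f (x /\<^sub>R norm x))"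
proof -
  let ?N = "distr (restrict_space lborel (ball 0 1 - {0}))
     (restrict_space borel (sphere 0 1)) (\<lambda>x::real^'n. x /\<^sub>R norm x)"
  have m: "f \<in> borel_measurable (restrict_space borel (sphere 0 1))"
    by (rule borel_measurable_continuous_on_restrict[OF f])
  have "(LINT x|sphere_measure. f x) = (LINT x|density ?N (\<lambda>_. ennreal (real CARD('n))). f x)"
    unfolding sphere_measure_density by (simp add: ennreal_of_nat_eq_real_of_nat)
  also have "\<dots> = (LINT x|?N. CARD('n) * f x)"
    by (subst integral_density) (use m in auto)
  also have "\<dots> = CARD('n) * (LINT x|restrict_space lborel (ball 0 1 - {0}). f (x /\<^sub>R norm x))"
    by (simp add: integral_distr[OF measurable_sphere_projection m])
  also have "\<dots> = CARD('n) * (LINT x|lborel. indicator (ball 0 1 - {0}) x * f (x /\<^sub>R norm x))"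
    by (subst integral_restrict_space) auto
  finally show ?thesis .
qed

text \<open>Expanding the argument in a basis reduces joint continuity to continuity for each fixed
  direction, which is the form that \<open>smooth\<close> provides.\<close>

lemma continuous_on_linear_apply:
  fixes L :: "'a::topological_space \<Rightarrow> 'b::euclidean_space \<Rightarrow> 'c::real_normed_vector"
  assumes L: "\<And>x. linear (L x)" "\<And>v. continuous_on UNIV (\<lambda>x. L x v)"
    and p: "continuous_on S p" and w: "continuous_on S w"
  shows "continuous_on S (\<lambda>x. L (p x) (w x))"
proof -
  have "L (p x) (w x) = (\<Sum>b\<in>Basis. (w x \<bullet> b) *\<^sub>R L (p x) b)" for x
    by (subst (1) euclidean_representation[of "w x", symmetric])
       (simp add: linear_sum[OF L(1)] linear_cmul[OF L(1)])
  moreover have "continuous_on S (\<lambda>x. \<Sum>b\<in>Basis. (w x \<bullet> b) *\<^sub>R L (p x) b)"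
    by (intro continuous_on_sum continuous_on_scaleR continuous_on_inner continuous_on_const w
        continuous_on_compose2[OF L(2) p]) auto
  ultimately show ?thesis by simp
qed

text \<open>The field \<open>\<eta>(\<bar>x\<bar>\<^sup>2) \<bar>x\<bar> X(x / \<bar>x\<bar>)\<close>, with a cutoff \<open>\<eta>\<close> vanishing near 0 and 1, has divergence
  \<open>\<eta>(\<bar>x\<bar>\<^sup>2) div X(x / \<bar>x\<bar>)\<close>, because \<open>X\<close> is tangential; then \<open>\<eta>\<close> tends to 1 on the punctured ball.\<close>

lemma integral_cutoff_sphere_divergence:
  fixes X :: "real^'n \<Rightarrow> real^'n" and X' :: "real^'n \<Rightarrow> real^'n \<Rightarrow> real^'n"
  assumes X: "\<And>x. (X has_derivative X' x) (at x)"
    and X': "\<And>v. continuous_on UNIV (\<lambda>x. X' x v)"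
    and tangential: "\<And>x. norm x = 1 \<Longrightarrow> X x \<bullet> x = 0"
    and \<eta>: "\<And>r. (\<eta> has_real_derivative \<eta>' r) (at r)" "continuous_on UNIV \<eta>'"
    and \<epsilon>: "\<epsilon> > 0" and \<eta>0: "\<And>r. r \<le> \<epsilon> \<Longrightarrow> \<eta> r = 0" "\<And>r. 1 \<le> r \<Longrightarrow> \<eta> r = 0"
  shows "(LINT x|lborel. \<eta> (x \<bullet> x) *
     ((\<Sum>b\<in>Basis. X' (x /\<^sub>R norm x) b \<bullet> b) - X' (x /\<^sub>R norm x) (x /\<^sub>R norm x) \<bullet> (x /\<^sub>R norm x))) = 0"
proof -
  define n where "n x = x /\<^sub>R norm x" for x :: "real^'n"
  \<comment> \<open>The factor \<open>norm x\<close> cancels the factor 1/|x| in the derivative of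
    \<open>n\<close>, so the derivative of \<open>X\<close> on the sphere enters unscaled.\<close>
  define Y where "Y x = (\<eta> (x \<bullet> x) * norm x) *\<^sub>R X (n x)" for x
  define E where "E x h = ((2 * \<eta>' (x \<bullet> x) * norm x * (x \<bullet> h) + \<eta> (x \<bullet> x) * (n x \<bullet> h)) *\<^sub>R X (n x)
      + \<eta> (x \<bullet> x) *\<^sub>R X' (n x) (h - (n x \<bullet> h) *\<^sub>R n x))" for x h
  note X'_linear = has_derivative_linear[OF X]
  have Xc: "continuous_on UNIV X"
    using X by (meson continuous_on_eq_continuous_at has_derivative_continuous open_UNIV)
  have \<eta>c: "continuous_on UNIV \<eta>" using \<eta>(1) by (meson DERIV_continuous_on has_field_derivative_at_within)
  have \<eta>'0: "\<eta>' r = 0" if "r < \<epsilon>" for r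
  proof -
    have "(\<eta> has_real_derivative 0) (at r)"
      by (rule has_field_derivative_transform_within_open[OF DERIV_const, of "{..<\<epsilon>}" _ 0])
         (use \<eta>0(1) that in auto)
    then show ?thesis using \<eta>(1) DERIV_unique by blast
  qed
  have U: "open {x::real^'n. x \<bullet> x < \<epsilon>}" by (intro open_Collect_less continuous_intros)
  have n1: "norm (n x) = 1" if "x \<noteq> 0" for x using that unfolding n_def by simp
  have Y: "(Y has_derivative E x) (at x)" for x
  proof (cases "x = 0")
    case True
    have "E x = (\<lambda>_. 0)" using True \<eta>0(1)[of 0] \<epsilon> by (auto simp: E_def n_def)
    \<comment> \<open>The origin is the singularity of \<open>n\<close>, but the cutoff makes
      \<open>Y\<close> vanish in a whole neighbourhood of it.\<close>
    moreover have "(Y has_derivative (\<lambda>_. 0)) (at x)"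
      by (rule has_derivative_transform_within_open[OF has_derivative_const U])
         (use True \<epsilon> \<eta>0(1) in \<open>auto simp: Y_def\<close>)
    ultimately show ?thesis by simp
  next
    case False
    then have nz: "norm x \<noteq> 0" by simp
    have N: "(norm has_derivative (\<lambda>h. n x \<bullet> h)) (at x)"
      using has_derivative_norm[OF False] by (simp add: n_def sgn_div_norm inner_commute)
    have "((\<lambda>x. inverse (norm x) *\<^sub>R x) has_derivative
        (\<lambda>h. inverse (norm x) *\<^sub>R h + (- (inverse (norm x) * (n x \<bullet> h) * inverse (norm x))) *\<^sub>R x)) (at x)"
      by (rule has_derivative_scaleR[OF Deriv.has_derivative_inverse[OF nz N] has_derivative_ident])
    then have n': "(n has_derivative (\<lambda>h. (h - (n x \<bullet> h) *\<^sub>R n x) /\<^sub>R norm x)) (at x)"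
      unfolding n_def[abs_def] by (rule has_derivative_eq_rhs) (auto simp: n_def algebra_simps)
    have q: "((\<lambda>x. x \<bullet> x) has_derivative (\<lambda>h. 2 * (x \<bullet> h))) (at x)"
      by (auto intro!: derivative_eq_intros simp: inner_commute)
    have c: "((\<lambda>x. \<eta> (x \<bullet> x)) has_derivative (\<lambda>h. \<eta>' (x \<bullet> x) * (2 * (x \<bullet> h)))) (at x)"
      using has_derivative_compose[OF q, of \<eta> "(*) (\<eta>' (x \<bullet> x))"] \<eta>(1)
      by (simp add: has_field_derivative_def)
    have "(Y has_derivative (\<lambda>h. (\<eta> (x \<bullet> x) * norm x) *\<^sub>R X' (n x) ((h - (n x \<bullet> h) *\<^sub>R n x) /\<^sub>R norm x)
        + (\<eta> (x \<bullet> x) * (n x \<bullet> h) + \<eta>' (x \<bullet> x) * (2 * (x \<bullet> h)) * norm x) *\<^sub>R X (n x))) (at x)"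
      unfolding Y_def[abs_def]
      by (rule has_derivative_scaleR[OF has_derivative_mult[OF c N] has_derivative_compose[OF n' X]])
    moreover have "(\<eta> (x \<bullet> x) * norm x) *\<^sub>R X' (n x) (w /\<^sub>R norm x) = \<eta> (x \<bullet> x) *\<^sub>R X' (n x) w" for w
      using False by (simp add: linear_cmul[OF X'_linear])
    ultimately have "(Y has_derivative (\<lambda>h. \<eta> (x \<bullet> x) *\<^sub>R X' (n x) (h - (n x \<bullet> h) *\<^sub>R n x)
        + (\<eta> (x \<bullet> x) * (n x \<bullet> h) + \<eta>' (x \<bullet> x) * (2 * (x \<bullet> h)) * norm x) *\<^sub>R X (n x))) (at x)"
      by (simp only:)
    then show ?thesis
      by (rule has_derivative_eq_rhs) (simp add: E_def fun_eq_iff algebra_simps)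
  qed
  have cont: "continuous_on UNIV (\<lambda>x. E x v \<bullet> w)" for v w
  proof -
    have 1: "continuous_on (- {0}) n" unfolding n_def[abs_def] by (intro continuous_intros) auto
    have q: "continuous_on S (\<lambda>x::real^'n. x \<bullet> x)" for S by (intro continuous_intros)
    have "continuous_on (- {0}) (\<lambda>x. E x v \<bullet> w)"
      unfolding E_def
      by (intro continuous_on_inner continuous_on_add continuous_on_scaleR continuous_on_mult
          continuous_on_const continuous_on_norm continuous_on_id continuous_on_diff 1
          continuous_on_compose2[OF Xc 1] continuous_on_compose2[OF \<eta>c q] continuous_on_compose2[OF \<eta>(2) q]
          continuous_on_linear_apply[OF X'_linear X']) auto
    moreover have "continuous_on {x. x \<bullet> x < \<epsilon>} (\<lambda>x. E x v \<bullet> w)"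
      by (rule continuous_on_eq[OF continuous_on_const[of _ 0]]) (auto simp: E_def \<eta>0(1) \<eta>'0)
    ultimately have "continuous_on (- {0} \<union> {x. x \<bullet> x < \<epsilon>}) (\<lambda>x. E x v \<bullet> w)"
      by (intro continuous_on_open_Un U) auto
    moreover have "- {0} \<union> {x. x \<bullet> x < \<epsilon>} = (UNIV :: (real^'n) set)" using \<epsilon> by auto
    ultimately show ?thesis by simp
  qed
  have supp: "Y x = 0" "E x h = 0" if "1 < norm x" for x h
  proof -
    have gt: "1 < x \<bullet> x" using that by (simp add: dot_square_norm power2_eq_square less_1_mult)
    have "(\<eta> has_real_derivative 0) (at (x \<bullet> x))"
      by (rule has_field_derivative_transform_within_open[OF DERIV_const, of "{1<..}" _ 0])
         (use \<eta>0(2) gt in auto)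
    then have "\<eta>' (x \<bullet> x) = 0" using \<eta>(1) DERIV_unique by blast
    then show "Y x = 0" "E x h = 0" using \<eta>0(2)[of "x \<bullet> x"] gt by (auto simp: Y_def E_def)
  qed
  have zero: "(LINT x|lborel. E x b \<bullet> b) = 0" for b
    by (rule integral_directional_derivative_eq_0[where h="\<lambda>x. Y x \<bullet> b" and h'="\<lambda>x h. E x h \<bullet> b" and r=1])
       (use supp cont in \<open>auto intro: has_derivative_inner_left[OF Y]\<close>)
  have trace: "(\<Sum>b\<in>Basis. E x b \<bullet> b) = \<eta> (x \<bullet> x) * ((\<Sum>b\<in>Basis. X' (n x) b \<bullet> b) - X' (n x) (n x) \<bullet> n x)" for x
  proof (cases "x = 0")
    case True
    then show ?thesis using \<eta>0(1)[of 0] \<epsilon> by (simp add: E_def)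
  next
    case False
    have s: "(\<Sum>b\<in>Basis. (u \<bullet> b) * (w \<bullet> b)) = u \<bullet> w" for u w :: "real^'n"
      by (simp add: euclidean_inner[of u w])
    \<comment> \<open>The terms with derivatives of the cutoff and of the norm pair
      \<open>X (n x)\<close> with a radial vector, so tangentiality removes them from the
      trace.\<close>
    have "x = norm x *\<^sub>R n x" using False by (simp add: n_def)
    then have "x \<bullet> X (n x) = norm x * (n x \<bullet> X (n x))" by (metis inner_scaleR_left)
    then have t: "x \<bullet> X (n x) = 0" "n x \<bullet> X (n x) = 0"
      using tangential[OF n1[OF False]] by (simp_all add: inner_commute)
    have "E x b \<bullet> b = 2 * \<eta>' (x \<bullet> x) * norm x * ((x \<bullet> b) * (X (n x) \<bullet> b))
        + \<eta> (x \<bullet> x) * ((n x \<bullet> b) * (X (n x) \<bullet> b))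
        + \<eta> (x \<bullet> x) * (X' (n x) b \<bullet> b) - \<eta> (x \<bullet> x) * ((n x \<bullet> b) * (X' (n x) (n x) \<bullet> b))" for b
      by (simp add: E_def linear_diff[OF X'_linear] linear_cmul[OF X'_linear] inner_add_left
          inner_diff_left algebra_simps)
    then have "(\<Sum>b\<in>Basis. E x b \<bullet> b) = 2 * \<eta>' (x \<bullet> x) * norm x * (x \<bullet> X (n x))
        + \<eta> (x \<bullet> x) * (n x \<bullet> X (n x))
        + \<eta> (x \<bullet> x) * (\<Sum>b\<in>Basis. X' (n x) b \<bullet> b) - \<eta> (x \<bullet> x) * (n x \<bullet> X' (n x) (n x))"
      by (simp only: sum.distrib sum_subtractf sum_distrib_left[symmetric] s)
    then show ?thesis using t by (simp add: algebra_simps inner_commute)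
  qed
  have "(LINT x|lborel. (\<Sum>b\<in>Basis. E x b \<bullet> b)) = (\<Sum>b\<in>Basis. LINT x|lborel. E x b \<bullet> b)"
    by (intro Bochner_Integration.integral_sum integrable_continuous_bounded_support[OF cont, of 1])
       (simp add: supp)
  then show ?thesis unfolding trace zero by (simp add: n_def)
qed

text \<open>Dominated convergence in \<open>integral_cutoff_sphere_divergence\<close>, with cutoffs
  exhausting the punctured ball.\<close>

theorem integral_sphere_divergence:
  fixes X :: "real^'n \<Rightarrow> real^'n" and X' :: "real^'n \<Rightarrow> real^'n \<Rightarrow> real^'n"
  assumes X: "\<And>x. (X has_derivative X' x) (at x)"
    and X': "\<And>v. continuous_on UNIV (\<lambda>x. X' x v)"
    and tangential: "\<And>x. norm x = 1 \<Longrightarrow> X x \<bullet> x = 0"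
  shows "(LINT x|sphere_measure. (\<Sum>b\<in>Basis. X' x b \<bullet> b) - X' x x \<bullet> x) = 0"
proof -
  let ?F = "\<lambda>x. (\<Sum>b\<in>Basis. X' x b \<bullet> b) - X' x x \<bullet> x"
  have F: "continuous_on S ?F" for S
    by (intro continuous_on_diff continuous_on_sum continuous_on_inner continuous_on_const continuous_on_id
        continuous_on_linear_apply[OF has_derivative_linear[OF X] X'] continuous_on_subset[OF X']) auto
  have "bounded (?F ` sphere 0 1)"
    by (intro compact_imp_bounded compact_continuous_image F) auto
  then obtain b where "\<forall>x\<in>sphere 0 1. \<bar>?F x\<bar> \<le> b" unfolding bounded_iff by auto
  then have b: "\<bar>?F x\<bar> \<le> b" if "norm x = 1" for x using that by simp
  \<comment> \<open>\<open>axis undefined 1\<close> merely serves as some unit vector.\<close>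
  have "b \<ge> 0" using b[of "axis undefined 1"] by (smt (verit) abs_ge_zero norm_axis_1)
  \<comment> \<open>The shifts by 2 make \<open>\<eta> k\<close> vanish for
    \<open>r \<le> 1/(k+1)\<close> and for \<open>r \<ge> 1 - 1/(k+1)\<close>, and equal 1 between
    \<open>3/(k+1)\<close> and \<open>1 - 3/(k+1)\<close>.\<close>
  define \<eta> where "\<eta> k r = ramp (real (Suc k) * r - 2) * ramp (real (Suc k) * (1 - r) - 2)" for k r
  define \<eta>' where "\<eta>' k r = real (Suc k) * tent (real (Suc k) * r - 2) * ramp (real (Suc k) * (1 - r) - 2)
    - real (Suc k) * tent (real (Suc k) * (1 - r) - 2) * ramp (real (Suc k) * r - 2)" for k r
  have d: "(\<eta> k has_real_derivative \<eta>' k r) (at r)" for k r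
  proof -
    have "((\<lambda>r. ramp (real (Suc k) * r - 2)) has_real_derivative tent (real (Suc k) * r - 2) * real (Suc k)) (at r)"
      by (rule DERIV_chain2[OF has_real_derivative_ramp]) (auto intro!: derivative_eq_intros)
    moreover have "((\<lambda>r. ramp (real (Suc k) * (1 - r) - 2)) has_real_derivative
        tent (real (Suc k) * (1 - r) - 2) * - real (Suc k)) (at r)"
      by (rule DERIV_chain2[OF has_real_derivative_ramp]) (auto intro!: derivative_eq_intros)
    ultimately show ?thesis unfolding \<eta>_def[abs_def] \<eta>'_def
      by (rule DERIV_cong[OF DERIV_mult]) (simp add: algebra_simps)
  qed
  have c: "continuous_on UNIV (\<eta>' k)" for k
    unfolding \<eta>'_def[abs_def]
    by (intro continuous_intros continuous_on_compose2[OF continuous_on_tent[of UNIV]]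
        continuous_on_compose2[OF continuous_on_ramp[of UNIV]]) auto
  have "\<eta> k r = 0" if "r \<le> 1 / real (Suc k)" for k r
    using that by (auto simp: \<eta>_def field_simps intro!: ramp_eq_0 disjI1)
  moreover have "\<eta> k r = 0" if "1 \<le> r" for k r
  proof -
    have "real (Suc k) * (1 - r) \<le> 0" using that by (intro mult_nonneg_nonpos) auto
    then show ?thesis by (simp add: \<eta>_def ramp_eq_0)
  qed
  note \<eta>0 = calculation this
  have zero: "(LINT x|lborel. \<eta> k (x \<bullet> x) * ?F (x /\<^sub>R norm x)) = 0" for k
    by (rule integral_cutoff_sphere_divergence[OF X X' tangential d c, of "1 / real (Suc k)"]) (use \<eta>0 in auto)
  have "(\<lambda>k. LINT x|lborel. \<eta> k (x \<bullet> x) * ?F (x /\<^sub>R norm x))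
      \<longlonglongrightarrow> (LINT x|lborel. indicator (ball 0 1 - {0}) x * ?F (x /\<^sub>R norm x))"
  proof (rule integral_dominated_convergence[where w="\<lambda>x. b * indicator (cball 0 1) x"])
    have m: "(\<lambda>x. indicator (S - {0}) x *\<^sub>R ?F (x /\<^sub>R norm x)) \<in> borel_measurable borel" if "S \<in> sets borel"
      for S :: "(real^'n) set"
      by (intro borel_measurable_continuous_on_indicator continuous_on_compose2[OF F[of UNIV]] continuous_intros)
         (use that in auto)
    from m[of "ball 0 1"] show "(\<lambda>x. indicator (ball 0 1 - {0}) x * ?F (x /\<^sub>R norm x)) \<in> borel_measurable lborel"
      by simp
    show "(\<lambda>x. \<eta> k (x \<bullet> x) * ?F (x /\<^sub>R norm x)) \<in> borel_measurable lborel" for k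
    proof -
      have "continuous_on UNIV (\<eta> k)"
        by (rule DERIV_continuous_on) (rule has_field_derivative_at_within[OF d])
      then have "continuous_on UNIV (\<lambda>x::real^'n. \<eta> k (x \<bullet> x))"
        by (rule continuous_on_compose2) (auto intro: continuous_on_inner continuous_on_id)
      from borel_measurable_times[OF borel_measurable_continuous_onI[OF this] m[of UNIV]]
      have "(\<lambda>x. \<eta> k (x \<bullet> x) * (indicator (UNIV - {0}) x *\<^sub>R ?F (x /\<^sub>R norm x))) \<in> borel_measurable borel" by simp
      \<comment> \<open>The projection to the sphere is discontinuous at the origin; the indicator
        removes that point, where \<open>\<eta> k\<close> is 0 anyway.\<close>
      also have "(\<lambda>x. \<eta> k (x \<bullet> x) * (indicator (UNIV - {0}) x *\<^sub>R ?F (x /\<^sub>R norm x)))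
          = (\<lambda>x. \<eta> k (x \<bullet> x) * ?F (x /\<^sub>R norm x))"
        by (auto simp: \<eta>0 indicator_def fun_eq_iff)
      finally show ?thesis by simp
    qed
    show "integrable lborel (\<lambda>x. b * indicator (cball (0::real^'n) 1) x)"
      by (intro integrable_mult_right integrable_real_indicator) (use emeasure_compact_finite[OF compact_cball] in auto)
    show "AE x in lborel. norm (\<eta> k (x \<bullet> x) * ?F (x /\<^sub>R norm x)) \<le> b * indicator (cball 0 1) x" for k
    proof (rule AE_I2)
      fix x :: "real^'n"
      have \<eta>1: "\<bar>\<eta> k r\<bar> \<le> 1" for r
        using ramp_nonneg ramp_le_1 by (auto simp: \<eta>_def abs_mult intro!: mult_le_one)
      consider "x = 0" | "norm x > 1" | "x \<noteq> 0" "norm x \<le> 1" by force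
      then show "norm (\<eta> k (x \<bullet> x) * ?F (x /\<^sub>R norm x)) \<le> b * indicator (cball 0 1) x"
      proof cases
        case 1
        then show ?thesis using \<open>b \<ge> 0\<close> by (simp add: \<eta>0)
      next
        case 2
        then have "1 \<le> x \<bullet> x" by (simp add: dot_square_norm)
        then show ?thesis using 2 by (simp add: \<eta>0)
      next
        case 3
        then have "\<bar>\<eta> k (x \<bullet> x)\<bar> * \<bar>?F (x /\<^sub>R norm x)\<bar> \<le> 1 * b"
          by (intro mult_mono \<eta>1 b) auto
        then show ?thesis using 3 by (simp add: abs_mult)
      qed
    qed
    show "AE x in lborel. (\<lambda>k. \<eta> k (x \<bullet> x) * ?F (x /\<^sub>R norm x))
        \<longlonglongrightarrow> indicator (ball 0 1 - {0}) x * ?F (x /\<^sub>R norm x)"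
    proof (rule AE_I2)
      fix x :: "real^'n"
      show "(\<lambda>k. \<eta> k (x \<bullet> x) * ?F (x /\<^sub>R norm x)) \<longlonglongrightarrow> indicator (ball 0 1 - {0}) x * ?F (x /\<^sub>R norm x)"
      proof (cases "x \<in> ball 0 1 - {0}")
        case True
        then have r: "0 < x \<bullet> x" "x \<bullet> x < 1" by (auto simp: dot_square_norm power_less_one_iff)
        obtain N where N: "max (3 / (x \<bullet> x)) (3 / (1 - x \<bullet> x)) \<le> real N" using real_arch_simple by blast
        have "eventually (\<lambda>k. 3 / (x \<bullet> x) \<le> real (Suc k) \<and> 3 / (1 - x \<bullet> x) \<le> real (Suc k)) sequentially"
          using eventually_ge_at_top[of N] by eventually_elim (use N in auto)
        then have "eventually (\<lambda>k. \<eta> k (x \<bullet> x) * ?F (x /\<^sub>R norm x) = ?F (x /\<^sub>R norm x)) sequentially"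
        proof eventually_elim
          case (elim k)
          then have "3 \<le> real (Suc k) * (x \<bullet> x)" "3 \<le> real (Suc k) * (1 - x \<bullet> x)"
            using r by (simp_all only: pos_divide_le_eq diff_gt_0_iff_gt)
          then have "1 \<le> real (Suc k) * (x \<bullet> x) - 2" "1 \<le> real (Suc k) * (1 - x \<bullet> x) - 2"
            by linarith+
          then show ?case by (simp only: \<eta>_def ramp_eq_1 mult_1)
        qed
        then show ?thesis using True by (simp add: tendsto_eventually)
      next
        case False
        then have "x = 0 \<or> 1 \<le> x \<bullet> x" by (auto simp: dot_square_norm)
        then have "\<eta> k (x \<bullet> x) = 0" for k using \<eta>0(1)[of 0 k] \<eta>0(2)[of "x \<bullet> x" k] by auto
        then show ?thesis using False by simp
      qed
    qed
  qed
  then have "(LINT x|lborel. indicator (ball 0 1 - {0}) x * ?F (x /\<^sub>R norm x)) = 0"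
    unfolding zero by (simp add: LIMSEQ_const_iff)
  then show ?thesis by (simp add: integral_sphere_measure[OF F])
qed

section \<open>The identity as a Sobolev map of the sphere\<close>

lemma smooth_has_derivative:
  assumes "smooth f"
  shows "(f has_derivative frechet_derivative f (at x)) (at x)"
    and "continuous_on UNIV (\<lambda>x. frechet_derivative f (at x) v)"
  using assms[unfolded smooth_def, rule_format, of 1]
  by (auto simp: frechet_derivative_works)

text \<open>The i-th row is the tangential projection of the i-th unit vector. Integration by parts
  is the divergence theorem for the tangential field \<open>x $ i\<close> times \<open>X\<close>,
  whose divergence on the sphere is \<open>x $ i * sphere_div X x + X x $ i\<close>.\<close>

lemma is_sphere_gradient_identity:
  "is_sphere_gradient (\<lambda>x. x :: real^'n) (\<lambda>x. (\<chi> i. axis i 1 - (x $ i) *\<^sub>R x))"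
  unfolding is_sphere_gradient_def
proof (intro conjI allI impI)
  show "AE x in sphere_measure. \<forall>i. (\<chi> i. axis i 1 - (x $ i) *\<^sub>R x) $ i \<bullet> (x::real^'n) = 0"
    by (intro AE_I2) (auto simp: space_sphere_measure inner_diff_left inner_axis' dot_square_norm)
next
  fix X :: "real^'n \<Rightarrow> real^'n" and i
  assume "tangential_field X"
  then have X: "smooth X" and tan: "X x \<bullet> x = 0" if "norm x = 1" for x
    using that by (auto simp: tangential_field_def)
  let ?X' = "\<lambda>x. frechet_derivative X (at x)"
  \<comment> \<open>The guard \<open>norm x = 1\<close> is attached to both facts above; any unit
    vector discharges it.\<close>
  have Xs: "smooth X" using X[of "axis undefined 1"] by simp
  note X' = smooth_has_derivative[OF Xs]
  have Xc: "continuous_on UNIV X"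
    using X'(1) by (meson continuous_on_eq_continuous_at has_derivative_continuous open_UNIV)
  have c: "continuous_on S X" "continuous_on S (\<lambda>x. sphere_div X x)" for S
    unfolding sphere_div_def
    by (intro continuous_on_diff continuous_on_sum continuous_on_inner continuous_on_const continuous_on_id
        continuous_on_linear_apply[OF has_derivative_linear[OF X'(1)] X'(2)] continuous_on_subset[OF X'(2)]
        continuous_on_subset[OF Xc] subset_UNIV)+
  have zero: "(LINT x|sphere_measure. (\<Sum>b\<in>Basis. ((b $ i) *\<^sub>R X x + (x $ i) *\<^sub>R ?X' x b) \<bullet> b)
      - ((x $ i) *\<^sub>R X x + (x $ i) *\<^sub>R ?X' x x) \<bullet> x) = 0"
  proof (rule integral_sphere_divergence[where X="\<lambda>x. (x $ i) *\<^sub>R X x"])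
    show "((\<lambda>x. (x $ i) *\<^sub>R X x) has_derivative (\<lambda>h. (h $ i) *\<^sub>R X x + (x $ i) *\<^sub>R ?X' x h)) (at x)" for x
      by (rule has_derivative_eq_rhs[OF has_derivative_scaleR[OF
            bounded_linear_imp_has_derivative[OF bounded_linear_vec_nth] X'(1)]]) (simp add: add.commute)
    show "continuous_on UNIV (\<lambda>x. (v $ i) *\<^sub>R X x + (x $ i) *\<^sub>R ?X' x v)" for v
      by (intro continuous_intros Xc X'(2))
    show "(x $ i) *\<^sub>R X x \<bullet> x = 0" if "norm x = 1" for x using tan[OF that] by simp
  qed
  have "(\<Sum>b\<in>Basis. ((b $ i) *\<^sub>R X x + (x $ i) *\<^sub>R ?X' x b) \<bullet> b) - ((x $ i) *\<^sub>R X x + (x $ i) *\<^sub>R ?X' x x) \<bullet> x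
      = x $ i * sphere_div X x + X x $ i" if "norm x = 1" for x
  proof -
    have "(\<Sum>b\<in>Basis. (b $ i) * (X x \<bullet> b)) = X x $ i"
      using euclidean_inner[of "axis i 1" "X x"] by (simp add: inner_axis inner_axis')
    then show ?thesis using tan[OF that]
      by (simp add: sphere_div_def inner_add_left sum.distrib sum_distrib_left[symmetric] algebra_simps)
  qed
  then have "0 = (LINT x|sphere_measure. x $ i * sphere_div X x + X x $ i)"
    unfolding zero[symmetric] by (intro Bochner_Integration.integral_cong refl) (simp add: space_sphere_measure)
  also have "\<dots> = (LINT x|sphere_measure. x $ i * sphere_div X x) + (LINT x|sphere_measure. X x $ i)"
    by (intro Bochner_Integration.integral_add integrable_sphere_measure continuous_intros c)
  also have "(LINT x|sphere_measure. X x $ i)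
      = (LINT x|sphere_measure. (\<chi> i. axis i 1 - (x $ i) *\<^sub>R x) $ i \<bullet> X x)"
  proof (intro Bochner_Integration.integral_cong refl)
    fix x :: "real^'n" assume "x \<in> space sphere_measure"
    then have "x \<bullet> X x = 0" using tan[of x] by (simp add: space_sphere_measure inner_commute)
    then show "X x $ i = (\<chi> i. axis i 1 - (x $ i) *\<^sub>R x) $ i \<bullet> X x"
      by (simp add: inner_diff_left inner_axis')
  qed
  finally show "(LINT x|sphere_measure. x $ i * sphere_div X x)
      = - (LINT x|sphere_measure. (\<chi> i. axis i 1 - (x $ i) *\<^sub>R x) $ i \<bullet> X x)" by simp
qed

lemma continuous_Lp_space_sphere_measure:
  fixes f :: "real^'n \<Rightarrow> 'b::euclidean_space"
  assumes f: "continuous_on (sphere 0 1) f" and "p > 0"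
  shows "f \<in> Lp_space p sphere_measure"
proof -
  have "continuous_on (sphere 0 1) (\<lambda>x. norm (f x) powr p)"
    using \<open>p > 0\<close> by (intro continuous_on_powr' continuous_on_norm f continuous_on_const) auto
  then show ?thesis
    unfolding Lp_space_def by (simp add: borel_measurable_sphere_measure integrable_sphere_measure f)
qed

lemma identity_sobolev_sphere_sphere:
  assumes "p > 0"
  shows "(\<lambda>x. x :: real^'n) \<in> sobolev_sphere_sphere p"
proof -
  have "continuous_on (sphere (0::real^'n) 1) (\<lambda>x. \<chi> i. axis i 1 - (x $ i) *\<^sub>R x)"
    by (intro continuous_intros)
  then show ?thesis
    unfolding sobolev_sphere_sphere_def sphere_sobolev_def
    using is_sphere_gradient_identity assms
    by (auto intro!: continuous_Lp_space_sphere_measure bexI AE_I2 simp: space_sphere_measure)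
qed

subsection \<open>A Poincare inequality near the sphere\<close>

lemma nn_integral_lborel_scaleR:
  fixes g :: "'a::euclidean_space \<Rightarrow> ennreal"
  assumes [measurable]: "g \<in> borel_measurable borel" and "c > 0"
  shows "(\<integral>\<^sup>+x. g x \<partial>lborel) = ennreal (c ^ DIM('a)) * (\<integral>\<^sup>+x. g (c *\<^sub>R x) \<partial>lborel)"
  using assms(2)
  by (subst lborel_affine[of c 0]) (auto simp: nn_integral_density nn_integral_distr nn_integral_cmult)

text \<open>Jensen's inequality for the fourth power, which lies above its tangent line at the mean
  value \<open>c\<close> of \<open>h\<close>.\<close>

lemma integral_power4_le:
  fixes h :: "real \<Rightarrow> real"
  assumes "a \<le> b" and h: "continuous_on {a..b} h"
  shows "(integral {a..b} h) ^ 4 \<le> (b - a) ^ 3 * integral {a..b} (\<lambda>t. h t ^ 4)"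
proof (cases "a = b")
  case False
  with assms have ab: "b - a > 0" by simp
  define c where "c = integral {a..b} h / (b - a)"
  have hi: "h integrable_on {a..b}" "(\<lambda>t. h t ^ 4) integrable_on {a..b}"
    by (intro integrable_continuous_real h continuous_intros)+
  have "((\<lambda>t. c ^ 4 + 4 * c ^ 3 * (h t - c)) has_integral
      ((b - a) * c ^ 4 + 4 * c ^ 3 * (integral {a..b} h - (b - a) * c))) {a..b}"
    using has_integral_const_real[of "c ^ 4" a b] has_integral_const_real[of c a b] \<open>a \<le> b\<close>
    by (intro has_integral_add has_integral_mult_right has_integral_diff integrable_integral hi) simp_all
  moreover have "integral {a..b} h - (b - a) * c = 0" using ab by (simp add: c_def)
  ultimately have 1: "((\<lambda>t. c ^ 4 + 4 * c ^ 3 * (h t - c)) has_integral (b - a) * c ^ 4) {a..b}" by simp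
  have "(b - a) * c ^ 4 \<le> integral {a..b} (\<lambda>t. h t ^ 4)"
  proof (rule has_integral_le[OF 1 integrable_integral[OF hi(2)]])
    fix t
    \<comment> \<open>The gap between the fourth power and its tangent line, factored into visibly
      nonnegative terms.\<close>
    have "0 \<le> (h t - c)\<^sup>2 * ((h t + c)\<^sup>2 + 2 * c\<^sup>2)" by simp
    also have "\<dots> = h t ^ 4 - (c ^ 4 + 4 * c ^ 3 * (h t - c))" by algebra
    finally show "c ^ 4 + 4 * c ^ 3 * (h t - c) \<le> h t ^ 4" by simp
  qed
  then have "(b - a) ^ 3 * ((b - a) * c ^ 4) \<le> (b - a) ^ 3 * integral {a..b} (\<lambda>t. h t ^ 4)"
    using ab by (intro mult_left_mono) auto
  moreover have "(b - a) ^ 3 * ((b - a) * c ^ 4) = (integral {a..b} h) ^ 4"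
  proof -
    have "(b - a) ^ 3 * ((b - a) * c ^ 4) = ((b - a) * c) ^ 4" by (simp add: power_mult_distrib eval_nat_numeral)
    also have "(b - a) * c = integral {a..b} h" using ab by (simp add: c_def)
    finally show ?thesis .
  qed
  ultimately show ?thesis by simp
qed simp

text \<open>Convexity of the fourth power, certified by writing the gap with squares.\<close>

lemma power4_add_le: "(a + b) ^ 4 \<le> 8 * (a ^ 4 + b ^ 4)" for a b :: real
proof -
  have "8 * (a ^ 4 + b ^ 4) - (a + b) ^ 4
      = 4 * (a\<^sup>2 - b\<^sup>2)\<^sup>2 + (a - b)\<^sup>2 * (2 * (a\<^sup>2 + b\<^sup>2) + (a + b)\<^sup>2)"
    by algebra
  also have "\<dots> \<ge> 0" by simp
  finally show ?thesis by simp
qed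

text \<open>Fundamental theorem of calculus along the ray from \<open>x\<close> to its projection,
  then \<open>integral_power4_le\<close>. The chain rule factor |x| is at most 1.\<close>

lemma norm_radial_difference_le:
  fixes w :: "real^'n \<Rightarrow> real^'m"
  assumes w: "\<And>x. (w has_derivative (*v) (W x)) (at x)" and W: "continuous_on UNIV W"
    and x: "x \<noteq> 0" "norm x \<le> 1"
  shows "norm (w (x /\<^sub>R norm x) - w x) ^ 4
    \<le> (1 / norm x - 1) ^ 3 * integral {1..1 / norm x} (\<lambda>l. norm (W (l *\<^sub>R x)) ^ 4)"
proof -
  let ?h = "\<lambda>l. norm (W (l *\<^sub>R x))"
  have le: "1 \<le> 1 / norm x" using x by (simp add: field_simps)
  have c: "continuous_on {1..1 / norm x} (\<lambda>l. W (l *\<^sub>R x))"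
    by (intro continuous_on_compose2[OF W] continuous_intros) auto
  have "((\<lambda>l. w (l *\<^sub>R x)) has_vector_derivative W (l *\<^sub>R x) *v x) (at l within {1..1 / norm x})" for l
  proof -
    have "((\<lambda>l. l *\<^sub>R x) has_derivative (\<lambda>d. d *\<^sub>R x)) (at l within {1..1 / norm x})"
      by (auto intro!: derivative_eq_intros)
    from has_derivative_compose[OF this w]
    show ?thesis by (simp add: has_vector_derivative_def matrix_vector_mult_scaleR)
  qed
  from fundamental_theorem_of_calculus[OF le this]
  have I: "((\<lambda>l. W (l *\<^sub>R x) *v x) has_integral w ((1 / norm x) *\<^sub>R x) - w (1 *\<^sub>R x)) {1..1 / norm x}" .
  then have "norm (w (x /\<^sub>R norm x) - w x) = norm (integral {1..1 / norm x} (\<lambda>l. W (l *\<^sub>R x) *v x))"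
    by (simp add: integral_unique inverse_eq_divide)
  also have "\<dots> \<le> integral {1..1 / norm x} ?h"
  proof (rule integral_norm_bound_integral)
    show "(\<lambda>l. W (l *\<^sub>R x) *v x) integrable_on {1..1 / norm x}" using I by blast
    show "?h integrable_on {1..1 / norm x}"
      by (intro integrable_continuous_real continuous_on_norm c)
    show "norm (W (l *\<^sub>R x) *v x) \<le> ?h l" for l
      using norm_matrix_vector_mult_le[of "W (l *\<^sub>R x)" x] x(2) mult_left_mono[OF x(2), of "?h l"] by simp
  qed
  finally have "norm (w (x /\<^sub>R norm x) - w x) ^ 4 \<le> integral {1..1 / norm x} ?h ^ 4"
    by (rule power_mono) simp
  also have "\<dots> \<le> (1 / norm x - 1) ^ 3 * integral {1..1 / norm x} (\<lambda>l. ?h l ^ 4)"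
    by (rule integral_power4_le[OF le continuous_on_norm[OF c]])
  finally show ?thesis .
qed

text \<open>A point is compared with its radial projection, and Fubini exchanges the integrals over
  \<open>x\<close> and over the ray. The constant is \<open>8 * (4 * d) ^ 3 * (4 * d)\<close>:
  convexity, Jensen, and the length of the ray parameter interval.\<close>

lemma nn_integral_annulus_le:
  fixes w :: "real^'n \<Rightarrow> real^'m" and d :: real
  defines "A \<equiv> {x::real^'n. 1 - 2 * d \<le> x \<bullet> x \<and> x \<bullet> x \<le> 1}"
  assumes w: "\<And>x. (w has_derivative (*v) (W x)) (at x)" and W: "continuous_on UNIV W"
    and d: "0 < d" "d \<le> 1/4"
  shows "(\<integral>\<^sup>+x. ennreal (norm (w x) ^ 4) * indicator A x \<partial>lborel)
    \<le> 8 * (\<integral>\<^sup>+x. ennreal (norm (w (x /\<^sub>R norm x)) ^ 4) * indicator A x \<partial>lborel)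
      + ennreal (2048 * d ^ 4) * (\<integral>\<^sup>+x. ennreal (norm (W x) ^ 4) * indicator A x \<partial>lborel)"
proof -
  have wc: "continuous_on UNIV w"
    using w by (meson continuous_on_eq_continuous_at has_derivative_continuous open_UNIV)
  have A: "A \<in> sets borel" unfolding A_def
    by (intro borel_closed closed_Collect_conj closed_Collect_le continuous_intros)
  have Am: "x \<noteq> 0" "norm x \<le> 1" "1/2 \<le> norm x" "1 - 2 * d \<le> norm x" if "x \<in> A" for x
  proof -
    have n: "1 - 2 * d \<le> (norm x)\<^sup>2" "(norm x)\<^sup>2 \<le> 1" using that by (auto simp: A_def dot_square_norm)
    then show le: "norm x \<le> 1" by (simp add: power_le_one_iff abs_square_le_1)
    then have "(norm x)\<^sup>2 \<le> norm x" by (simp add: power2_eq_square mult_left_le)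
    with n d show "1/2 \<le> norm x" "1 - 2 * d \<le> norm x" by auto
    then show "x \<noteq> 0" by auto
  qed
  define g where "g x = ennreal (norm (W x) ^ 4) * indicator A x" for x
  have g[measurable]: "g \<in> borel_measurable borel"
    unfolding g_def[abs_def] using A
    by (intro borel_measurable_times_ennreal borel_measurable_indicator measurable_compose[OF _ measurable_ennreal]
        borel_measurable_continuous_onI continuous_on_power continuous_on_norm W)
  have wm[measurable]: "(\<lambda>x. ennreal (norm (w (x /\<^sub>R norm x)) ^ 4)) \<in> borel_measurable borel"
  proof -
    have [measurable]: "w \<in> borel_measurable borel" by (rule borel_measurable_continuous_onI[OF wc])
    show ?thesis by measurable
  qed
  note [measurable] = A
  \<comment> \<open>The upper limit \<open>1 / norm x\<close> is enlarged to
    \<open>1 + 4 * d\<close>, independent of \<open>x\<close>, so that Fubini runs over a product;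
    the indicator in \<open>g\<close> discards points that leave \<open>A\<close>.\<close>
  define J where "J x = (\<integral>\<^sup>+l. g (l *\<^sub>R x) * indicator {1..1 + 4 * d} l \<partial>lborel)" for x
  have "(\<lambda>(x, l). g (l *\<^sub>R x) * indicator {1..1 + 4 * d} l) \<in> borel_measurable (lborel \<Otimes>\<^sub>M lborel)"
    by measurable
  then have Jm[measurable]: "J \<in> borel_measurable borel"
    unfolding J_def[abs_def]  using lborel.borel_measurable_nn_integral by simp
  have pt: "ennreal (norm (w x) ^ 4) * indicator A x
      \<le> 8 * (ennreal (norm (w (x /\<^sub>R norm x)) ^ 4) * indicator A x) + ennreal (512 * d ^ 3) * J x" for x
  proof (cases "x \<in> A")
    case True
    note x = Am[OF True]
    have L: "0 \<le> 1 / norm x - 1" "1 / norm x - 1 \<le> 4 * d"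
    proof -
      show "0 \<le> 1 / norm x - 1" using x by (simp add: field_simps)
      \<comment> \<open>The product is \<open>1 + 2 * d - 8 * d ^ 2\<close>, which is at least 1
        because \<open>d \<le> 1/4\<close>.\<close>
      have "1 \<le> (1 - 2 * d) * (1 + 4 * d)" using mult_left_mono[of "4 * d" 1 "2 * d"] d by (simp add: algebra_simps)
      also have "\<dots> \<le> norm x * (1 + 4 * d)" using x d by (intro mult_right_mono) auto
      finally show "1 / norm x - 1 \<le> 4 * d" using x by (simp add: divide_le_eq algebra_simps)
    qed
    let ?I = "integral {1..1 / norm x} (\<lambda>l. norm (W (l *\<^sub>R x)) ^ 4)"
    have c: "continuous_on {1..1 / norm x} (\<lambda>l. norm (W (l *\<^sub>R x)) ^ 4)"
      by (intro continuous_on_compose2[OF W] continuous_intros) auto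
    have I0: "0 \<le> ?I" by (intro Henstock_Kurzweil_Integration.integral_nonneg integrable_continuous_real c) auto
    have "norm (w x) ^ 4 \<le> (norm (w (x /\<^sub>R norm x)) + norm (w (x /\<^sub>R norm x) - w x)) ^ 4"
      by (intro power_mono) (auto simp: norm_triangle_sub norm_minus_commute)
    also have "\<dots> \<le> 8 * (norm (w (x /\<^sub>R norm x)) ^ 4 + norm (w (x /\<^sub>R norm x) - w x) ^ 4)"
      by (rule power4_add_le)
    also have "norm (w (x /\<^sub>R norm x) - w x) ^ 4 \<le> (1 / norm x - 1) ^ 3 * ?I"
      by (rule norm_radial_difference_le[OF w W x(1,2)])
    also have "(1 / norm x - 1) ^ 3 * ?I \<le> (4 * d) ^ 3 * ?I"
      using L I0 by (intro mult_right_mono power_mono) auto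
    finally have "norm (w x) ^ 4 \<le> 8 * norm (w (x /\<^sub>R norm x)) ^ 4 + (512 * d ^ 3) * ?I"
      by (simp add: power_mult_distrib algebra_simps)
    then have "ennreal (norm (w x) ^ 4) \<le> 8 * ennreal (norm (w (x /\<^sub>R norm x)) ^ 4) + ennreal (512 * d ^ 3) * ennreal ?I"
      using I0 d by (simp add: ennreal_plus[symmetric] ennreal_mult[symmetric] ennreal_numeral[symmetric]
         del: ennreal_plus ennreal_numeral)
    also have "ennreal ?I = (\<integral>\<^sup>+l. ennreal (norm (W (l *\<^sub>R x)) ^ 4) * indicator {1..1 / norm x} l \<partial>lborel)"
      using integrable_integral[OF integrable_continuous_real[OF c]]
      by (intro nn_integral_has_integral_lebesgue'[symmetric]) auto
    also have "\<dots> \<le> J x"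
      unfolding J_def
    proof (rule nn_integral_mono)
      fix l :: real
      show "ennreal (norm (W (l *\<^sub>R x)) ^ 4) * indicator {1..1 / norm x} l \<le> g (l *\<^sub>R x) * indicator {1..1 + 4 * d} l"
      proof (cases "l \<in> {1..1 / norm x}")
        case l: True
        have "l * norm x \<le> 1" using l x by (simp add: le_divide_eq)
        then have "(l * norm x)\<^sup>2 \<le> 1" using l by (simp add: abs_square_le_1)
        moreover have "x \<bullet> x \<le> (l * norm x)\<^sup>2"
          using l by (auto simp: dot_square_norm intro!: power_mono mult_le_cancel_right1[THEN iffD2])
        moreover have "(l *\<^sub>R x) \<bullet> (l *\<^sub>R x) = (l * norm x)\<^sup>2"
          by (simp add: dot_square_norm power2_eq_square)
        ultimately have "l *\<^sub>R x \<in> A" using True unfolding A_def mem_Collect_eq by linarith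
        then show ?thesis using l L by (simp add: g_def)
      qed simp
    qed
    finally show ?thesis using True by (simp add: mult_left_mono add_left_mono)
  qed simp
  have "(\<integral>\<^sup>+x. J x \<partial>lborel) = (\<integral>\<^sup>+l. \<integral>\<^sup>+x. g (l *\<^sub>R x) * indicator {1..1 + 4 * d} l \<partial>lborel \<partial>lborel)"
    unfolding J_def by (rule lborel_pair.Fubini'[symmetric]) measurable
  also have "\<dots> \<le> (\<integral>\<^sup>+l. (\<integral>\<^sup>+x. g x \<partial>lborel) * indicator {1..1 + 4 * d} l \<partial>lborel)"
  proof (rule nn_integral_mono)
    fix l :: real
    show "(\<integral>\<^sup>+x. g (l *\<^sub>R x) * indicator {1..1 + 4 * d} l \<partial>lborel) \<le> (\<integral>\<^sup>+x. g x \<partial>lborel) * indicator {1..1 + 4 * d} l"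
    proof (cases "l \<in> {1..1 + 4 * d}")
      case True
      \<comment> \<open>The Jacobian of scaling by \<open>l\<close> is at least 1, so it may be
        inserted to undo the substitution.\<close>
      then have "1 \<le> ennreal (l ^ CARD('n))" by (simp add: one_le_power)
      then have "(\<integral>\<^sup>+x. g (l *\<^sub>R x) \<partial>lborel) \<le> ennreal (l ^ CARD('n)) * (\<integral>\<^sup>+x. g (l *\<^sub>R x) \<partial>lborel)"
        using mult_right_mono[of 1 "ennreal (l ^ CARD('n))" "\<integral>\<^sup>+x. g (l *\<^sub>R x) \<partial>lborel"] by simp
      also have "\<dots> = (\<integral>\<^sup>+x. g x \<partial>lborel)" using nn_integral_lborel_scaleR[OF g, of l] True by simp
      finally show ?thesis using True by simp
    qed simp
  qed
  also have "\<dots> = ennreal (4 * d) * (\<integral>\<^sup>+x. g x \<partial>lborel)"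
    using d by (simp add: nn_integral_cmult mult.commute)
  finally have J: "(\<integral>\<^sup>+x. J x \<partial>lborel) \<le> ennreal (4 * d) * (\<integral>\<^sup>+x. g x \<partial>lborel)" .
  have "(\<integral>\<^sup>+x. ennreal (norm (w x) ^ 4) * indicator A x \<partial>lborel)
      \<le> (\<integral>\<^sup>+x. 8 * (ennreal (norm (w (x /\<^sub>R norm x)) ^ 4) * indicator A x) + ennreal (512 * d ^ 3) * J x \<partial>lborel)"
    by (intro nn_integral_mono pt)
  also have "\<dots> = 8 * (\<integral>\<^sup>+x. ennreal (norm (w (x /\<^sub>R norm x)) ^ 4) * indicator A x \<partial>lborel)
      + ennreal (512 * d ^ 3) * (\<integral>\<^sup>+x. J x \<partial>lborel)"
    by (simp add: nn_integral_add nn_integral_cmult)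
  also have "ennreal (512 * d ^ 3) * (\<integral>\<^sup>+x. J x \<partial>lborel) \<le> ennreal (512 * d ^ 3) * (ennreal (4 * d) * (\<integral>\<^sup>+x. g x \<partial>lborel))"
    by (intro mult_left_mono J) simp
  also have "ennreal (512 * d ^ 3) * (ennreal (4 * d) * (\<integral>\<^sup>+x. g x \<partial>lborel)) = ennreal (2048 * d ^ 4) * (\<integral>\<^sup>+x. g x \<partial>lborel)"
    using d by (simp add: mult.assoc[symmetric] ennreal_mult[symmetric] eval_nat_numeral)
  finally show ?thesis unfolding g_def by (simp add: add_left_mono)
qed

subsection \<open>Invariance of the degree under gluing\<close>

lemma norm_matrix_le_sum_abs:
  fixes A :: "real^'n^'m"
  shows "norm A \<le> (\<Sum>i\<in>UNIV. \<Sum>j\<in>UNIV. \<bar>A $ i $ j\<bar>)"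
proof -
  have "norm A \<le> (\<Sum>i\<in>UNIV. norm (A $ i))"
    unfolding norm_vec_def[of A] by (rule L2_set_le_sum) simp
  also have "\<dots> \<le> (\<Sum>i\<in>UNIV. \<Sum>j\<in>UNIV. \<bar>A $ i $ j\<bar>)"
    by (intro sum_mono norm_le_l1_cart)
  finally show ?thesis .
qed

text \<open>The Jacobian determinant \<open>cube_density\<close> of this map is supported in the cube
  \<open>\<bar>x\<^sub>i\<bar> \<le> 1/4\<close>, which in dimension 4 does not meet the unit sphere.\<close>

definition cube_collapse :: "real^'n \<Rightarrow> real^'n" where
  "cube_collapse x = (\<chi> i. ramp (4 * x $ i))"

definition cube_collapse_deriv :: "real^'n \<Rightarrow> real^'n^'n" where
  "cube_collapse_deriv x = (\<chi> i j. if i = j then 4 * tent (4 * x $ i) else 0)"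

definition cube_density :: "real^'n \<Rightarrow> real" where
  "cube_density x = (\<Prod>i\<in>UNIV. 4 * tent (4 * x $ i))"

lemma has_derivative_cube_collapse:
  fixes x :: "real^'n"
  shows "(cube_collapse has_derivative (*v) (cube_collapse_deriv x)) (at x)"
  unfolding cube_collapse_def[abs_def]
proof (subst has_derivative_componentwise_within, intro ballI)
  fix b :: "real^'n" assume "b \<in> Basis"
  then obtain i where b: "b = axis i 1" by (auto simp: Basis_vec_def)
  have "((\<lambda>s. ramp (4 * s)) has_real_derivative tent (4 * s) * 4) (at s)" for s
    by (rule DERIV_chain2[OF has_real_derivative_ramp]) (auto intro!: derivative_eq_intros)
  then have "((\<lambda>s. ramp (4 * s)) has_derivative (*) (tent (4 * s) * 4)) (at s)" for s
    by (simp add: has_field_derivative_def)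
  from has_derivative_compose[OF bounded_linear_imp_has_derivative[OF bounded_linear_vec_nth] this]
  have "((\<lambda>x. ramp (4 * x $ i)) has_derivative (\<lambda>h. tent (4 * x $ i) * 4 * h $ i)) (at x)" .
  moreover have "(cube_collapse_deriv x *v h) $ i = tent (4 * x $ i) * 4 * h $ i" for h
    by (simp add: matrix_vector_mult_def cube_collapse_deriv_def if_distrib[of "\<lambda>c. c * _"] cong: if_cong)
  ultimately show "((\<lambda>x. (\<chi> i. ramp (4 * x $ i)) \<bullet> b) has_derivative (\<lambda>h. (cube_collapse_deriv x *v h) \<bullet> b)) (at x)"
    by (simp add: b inner_axis)
qed

lemma continuous_on_cube_collapse_deriv: "continuous_on (S :: (real^'n) set) cube_collapse_deriv"
  unfolding cube_collapse_deriv_def[abs_def]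
proof (intro continuous_on_vec_lambda)
  fix i j :: 'n
  show "continuous_on S (\<lambda>x. if i = j then 4 * tent (4 * x $ i) else 0)"
    by (cases "i = j") (auto intro!: continuous_intros continuous_on_compose2[OF continuous_on_tent[of UNIV]])
qed

lemma det_cube_collapse_deriv: "det (cube_collapse_deriv x) = cube_density x"
  by (subst det_diagonal) (auto simp: cube_collapse_deriv_def cube_density_def)

lemma norm_cube_collapse_deriv_le:
  "norm (cube_collapse_deriv (x::real^'n)) \<le> 4 * real (CARD('n) * CARD('n))"
proof -
  have "norm (cube_collapse_deriv x) \<le> (\<Sum>i\<in>(UNIV::'n set). \<Sum>j\<in>(UNIV::'n set). 4)"
    by (rule order_trans[OF norm_matrix_le_sum_abs], intro sum_mono)
       (use tent_nonneg tent_le_1 in \<open>auto simp: cube_collapse_deriv_def abs_of_nonneg\<close>)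
  then show ?thesis by simp
qed

lemma cube_density_nonneg: "0 \<le> cube_density x"
  unfolding cube_density_def by (intro prod_nonneg) (simp add: tent_nonneg)

lemma cube_density_le: "cube_density (x::real^'n) \<le> 4 ^ CARD('n)"
proof -
  have "cube_density x \<le> (\<Prod>i\<in>(UNIV::'n set). 4)"
    unfolding cube_density_def by (intro prod_mono) (use tent_nonneg tent_le_1 in auto)
  then show ?thesis by simp
qed

lemma continuous_on_cube_density: "continuous_on S cube_density"
  unfolding cube_density_def[abs_def]
  by (intro continuous_on_prod continuous_on_mult continuous_on_const
      continuous_on_compose2[OF continuous_on_tent[of UNIV]] continuous_on_component continuous_on_id subset_UNIV)

text \<open>If all coordinates were below 1/4 in modulus, the squared norm would be at most 4/16, so
  some factor of the product vanishes.\<close>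

lemma cube_density_eq_0:
  fixes x :: "real^4"
  assumes "norm x = 1"
  shows "cube_density x = 0"
proof -
  have "\<exists>i. 1 \<le> \<bar>4 * x $ i\<bar>"
  proof (rule ccontr)
    assume "\<not> ?thesis"
    then have "\<bar>x $ i\<bar> \<le> 1/4" for i by (simp add: not_le abs_mult) (metis less_imp_le mult.commute pos_less_divide_eq zero_less_numeral)
    then have "norm x \<le> (\<Sum>i\<in>UNIV. \<bar>x $ i\<bar>) \<and> (x $ i)\<^sup>2 \<le> (1/4)\<^sup>2" for i
      by (metis norm_le_l1_cart abs_le_square_iff abs_of_pos zero_less_divide_1_iff zero_less_numeral)
    then have "(\<Sum>i\<in>UNIV. (x $ i)\<^sup>2) \<le> (\<Sum>i\<in>(UNIV::4 set). (1/4)\<^sup>2)" by (intro sum_mono) auto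
    moreover have "(\<Sum>i\<in>UNIV. (x $ i)\<^sup>2) = x \<bullet> x" by (simp add: inner_vec_def power2_eq_square)
    ultimately show False using assms by (simp add: dot_square_norm power2_eq_square)
  qed
  then obtain i where "4 * tent (4 * x $ i) = 0" using tent_eq_0 by auto
  then show ?thesis unfolding cube_density_def by (intro prod_zero) auto
qed

text \<open>On the ball of radius 1/8 every \<open>tent\<close> factor is at least 1/2, so the
  density is at least 1 there.\<close>

lemma integral_cube_density_pos: "0 < integral (cball 0 1) (cube_density :: real^'n \<Rightarrow> real)"
proof -
  have ge: "1 \<le> cube_density x" if "x \<in> cball 0 (1/8)" for x :: "real^'n"
  proof -
    have "1 \<le> 4 * tent (4 * x $ i)" for i
      using tent_ge[of "4 * x $ i"] component_le_norm_cart[of x i] that by (simp add: abs_mult)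
    then show ?thesis unfolding cube_density_def by (intro prod_ge_1) simp
  qed
  have int: "cube_density integrable_on cball 0 r" for r :: real
    by (intro integrable_on_compact continuous_on_cube_density) auto
  have "0 < measure lebesgue (cball (0::real^'n) (1/8))" by (simp add: measure_completion content_cball_pos)
  also have "\<dots> = integral (cball (0::real^'n) (1/8)) (\<lambda>_. 1)"
    by (rule lmeasure_integral) simp
  also have "\<dots> \<le> integral (cball (0::real^'n) (1/8)) cube_density"
    by (rule integral_le) (auto intro: int ge simp: integrable_on_const)
  also have "\<dots> \<le> integral (cball (0::real^'n) 1) cube_density"
    by (rule integral_subset_le) (auto intro: int cube_density_nonneg)
  finally show ?thesis .
qed

section \<open>Gluing a map to the identity across a collar\<close>

definition outer :: "real^'m \<Rightarrow> real^'n \<Rightarrow> real^'n^'m" where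
  "outer a b = (\<chi> i. (a $ i) *\<^sub>R b)"

lemma outer_mult_vec: "outer a b *v h = (b \<bullet> h) *\<^sub>R a"
  by (simp add: outer_def vec_eq_iff matrix_vector_mul_component mult.commute)

lemma norm_outer: "norm (outer a b) = norm a * norm b"
  by (simp add: outer_def norm_vec_def[of "\<chi> i. _ i"] norm_vec_def[of a] L2_set_left_distrib)

text \<open>The argument \<open>r\<close> stands for the squared norm, which is smooth at the origin
  as well. The descent from 1 to 0 takes place on \<open>[1 - 2 * d, 1]\<close>.\<close>

definition cutoff :: "real \<Rightarrow> real \<Rightarrow> real" where
  "cutoff d r = 1 - ramp ((r - (1 - d)) / d)"

definition cutoff_deriv :: "real \<Rightarrow> real \<Rightarrow> real" where
  "cutoff_deriv d r = - (tent ((r - (1 - d)) / d) / d)"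

text \<open>The map \<open>x + \<eta> (v x - x)\<close> with a cutoff \<open>\<eta>\<close> that is 1 for \<open>\<bar>x\<bar>\<^sup>2 \<le> 1 - 2 d\<close> and 0 for
  \<open>\<bar>x\<bar> \<ge> 1\<close>: it agrees with \<open>v\<close> inside and with the identity outside.\<close>

definition glue :: "real \<Rightarrow> (real^'n \<Rightarrow> real^'n) \<Rightarrow> real^'n \<Rightarrow> real^'n" where
  "glue d v x = x + cutoff d (x \<bullet> x) *\<^sub>R (v x - x)"

definition glue_deriv ::
    "real \<Rightarrow> (real^'n \<Rightarrow> real^'n) \<Rightarrow> (real^'n \<Rightarrow> real^'n^'n) \<Rightarrow> real^'n \<Rightarrow> real^'n^'n" where
  "glue_deriv d v V x = mat 1 + cutoff d (x \<bullet> x) *\<^sub>R (V x - mat 1)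
     + (2 * cutoff_deriv d (x \<bullet> x)) *\<^sub>R outer (v x - x) x"

lemma has_real_derivative_cutoff:
  assumes "d > 0"
  shows "(cutoff d has_real_derivative cutoff_deriv d r) (at r)"
proof -
  have "((\<lambda>r. ramp ((r - (1 - d)) / d)) has_real_derivative tent ((r - (1 - d)) / d) * (1 / d)) (at r)"
    by (rule DERIV_chain2[OF has_real_derivative_ramp]) (use assms in \<open>auto intro!: derivative_eq_intros\<close>)
  from DERIV_diff[OF DERIV_const this, of 1] show ?thesis
    by (simp add: cutoff_def[abs_def] cutoff_deriv_def)
qed

lemma continuous_on_cutoff: "d > 0 \<Longrightarrow> continuous_on S (cutoff d)"
  and continuous_on_cutoff_deriv: "d > 0 \<Longrightarrow> continuous_on S (cutoff_deriv d)"
  unfolding cutoff_def[abs_def] cutoff_deriv_def[abs_def]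
  by (intro continuous_intros continuous_on_compose2[OF continuous_on_tent[of UNIV]]
      continuous_on_compose2[OF continuous_on_ramp[of UNIV]]; simp)+

lemma cutoff_bounds: "0 \<le> cutoff d r" "cutoff d r \<le> 1"
  using ramp_nonneg ramp_le_1 by (simp_all add: cutoff_def)

lemma abs_cutoff_deriv_le: "d > 0 \<Longrightarrow> \<bar>cutoff_deriv d r\<bar> \<le> 1 / d"
  using tent_nonneg tent_le_1 by (simp add: cutoff_deriv_def divide_right_mono)

lemma cutoff_outside: "d > 0 \<Longrightarrow> 1 \<le> r \<Longrightarrow> cutoff d r = 0" "d > 0 \<Longrightarrow> 1 \<le> r \<Longrightarrow> cutoff_deriv d r = 0"
  by (simp_all add: cutoff_def cutoff_deriv_def ramp_eq_1 tent_eq_0 le_divide_eq)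

lemma cutoff_inside:
  assumes "d > 0" "r \<le> 1 - 2 * d"
  shows "cutoff d r = 1" "cutoff_deriv d r = 0"
proof -
  have "(r - (1 - d)) / d \<le> -1" using assms by (simp add: divide_le_eq)
  moreover from this have "1 \<le> \<bar>(r - (1 - d)) / d\<bar>" by linarith
  ultimately show "cutoff d r = 1" "cutoff_deriv d r = 0"
    by (simp_all add: cutoff_def cutoff_deriv_def ramp_eq_0 tent_eq_0)
qed

lemma has_derivative_glue:
  assumes d: "d > 0" and v: "(v has_derivative (*v) (V x)) (at x)"
  shows "(glue d v has_derivative (*v) (glue_deriv d v V x)) (at x)"
proof -
  have "((\<lambda>x. x \<bullet> x) has_derivative (\<lambda>h. 2 * (x \<bullet> h))) (at x)"
    by (auto intro!: derivative_eq_intros simp: inner_commute)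
  from has_derivative_compose[OF this has_real_derivative_cutoff[OF d, unfolded has_field_derivative_def]]
  have c: "((\<lambda>x. cutoff d (x \<bullet> x)) has_derivative (\<lambda>h. cutoff_deriv d (x \<bullet> x) * (2 * (x \<bullet> h)))) (at x)" .
  show ?thesis
    unfolding glue_def[abs_def]
    by (rule has_derivative_eq_rhs[OF has_derivative_add[OF has_derivative_ident
          has_derivative_scaleR[OF c has_derivative_diff[OF v has_derivative_ident]]]])
       (simp add: glue_deriv_def fun_eq_iff matrix_vector_mult_add_rdistrib matrix_vector_mult_diff_rdistrib
          scaleR_matrix_vector_assoc[symmetric] outer_mult_vec algebra_simps)
qed

lemma continuous_on_glue_deriv:
  assumes d: "d > 0" and v: "continuous_on S v" and V: "continuous_on S V"
  shows "continuous_on S (glue_deriv d v V)"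
  unfolding glue_deriv_def[abs_def] outer_def
  by (intro continuous_on_add continuous_on_const continuous_on_scaleR continuous_on_diff v V
      continuous_on_vec_lambda continuous_on_component continuous_on_mult continuous_on_id
      continuous_on_compose2[OF continuous_on_cutoff[OF d, of UNIV]]
      continuous_on_compose2[OF continuous_on_cutoff_deriv[OF d, of UNIV]] continuous_on_inner subset_UNIV)

text \<open>Degree invariance for \<open>cube_collapse\<close> and its composition with the glued
  map, which agree off the ball. By the chain rule the determinant of the composition splits into
  density times Jacobian.\<close>

lemma integral_cube_density_glue:
  fixes v :: "real^'n::{finite,wellorder} \<Rightarrow> real^'n::_"
    and V :: "real^'n::_ \<Rightarrow> real^'n::_^'n::_"
  assumes d: "d > 0" and v: "\<And>x. (v has_derivative (*v) (V x)) (at x)" and V: "continuous_on UNIV V"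
  shows "integral (cball (0::real^'n::_) 1) cube_density
    = integral (cball 0 1) (\<lambda>x. cube_density (glue d v x) * det (glue_deriv d v V x))"
proof -
  have vc: "continuous_on UNIV v"
    using v by (meson continuous_on_eq_continuous_at has_derivative_continuous open_UNIV)
  let ?G = "\<lambda>x. cube_collapse_deriv (glue d v x) ** glue_deriv d v V x"
  have g: "(glue d v has_derivative (*v) (glue_deriv d v V x)) (at x)" for x
    by (rule has_derivative_glue[OF d v])
  have gc: "continuous_on UNIV (glue d v)"
    using g by (meson continuous_on_eq_continuous_at has_derivative_continuous open_UNIV)
  have G: "continuous_on UNIV ?G"
    unfolding matrix_matrix_mult_def
    by (intro continuous_on_vec_lambda continuous_on_sum continuous_on_mult continuous_on_component
        continuous_on_glue_deriv[OF d vc V] continuous_on_compose2[OF continuous_on_cube_collapse_deriv[of UNIV] gc] subset_UNIV)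
  have "bounded (?G ` cball 0 1)"
    by (intro compact_imp_bounded compact_continuous_image continuous_on_subset[OF G]) auto
  then obtain b where "\<forall>x\<in>cball 0 1. norm (?G x) \<le> b" unfolding bounded_iff by auto
  moreover have out: "glue d v x = x" "?G x = cube_collapse_deriv x" if "x \<notin> cball 0 1" for x
  proof -
    have "1 \<le> x \<bullet> x" using that by (simp add: dot_square_norm)
    then show "glue d v x = x" "?G x = cube_collapse_deriv x"
      using cutoff_outside[OF d] by (simp_all add: glue_def glue_deriv_def)
  qed
  \<comment> \<open>Compactness bounds the derivative on the ball; outside, the glued map is the
    identity and the explicit bound for the collapse applies.\<close>
  ultimately have b: "norm (?G x) \<le> max b (4 * real (CARD('n) * CARD('n)))" for x
    using norm_cube_collapse_deriv_le[of x] by (cases "x \<in> cball 0 1") (auto simp: max.coboundedI1 max.coboundedI2)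
  have cg: "((\<lambda>x. cube_collapse (glue d v x)) has_derivative (*v) (?G x)) (at x)" for x
    using has_derivative_compose[OF g has_derivative_cube_collapse]
    by (simp add: matrix_vector_mul_assoc)
  have "integral (cball 0 1) (\<lambda>x::real^'n::_. det (cube_collapse_deriv x)) = integral (cball 0 1) (\<lambda>x. det (?G x))"
    by (rule integral_det_derivative_eq[OF has_derivative_cube_collapse cg continuous_on_cube_collapse_deriv
          order_trans[OF norm_cube_collapse_deriv_le max.cobounded2] G b compact_cball])
       (use out(1) in simp)
  then show ?thesis by (simp add: det_mul det_cube_collapse_deriv)
qed

lemma power4_add4_le: "(a + b + c + e) ^ 4 \<le> 64 * (a ^ 4 + b ^ 4 + c ^ 4 + e ^ 4)" for a b c e :: real
  using power4_add_le[of "a + b" "c + e"] power4_add_le[of a b] power4_add_le[of c e]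
  by (simp add: add.assoc)

subsection \<open>Integrals over the ball\<close>

lemma borel_measurable_lebesgue_on:
  "f \<in> borel_measurable borel \<Longrightarrow> f \<in> borel_measurable (lebesgue_on S)"
  for f :: "'a::euclidean_space \<Rightarrow> 'b::topological_space"
  by (intro measurable_restrict_space1 measurable_completion) simp

text \<open>The sphere is a null set, so the open ball with completed measure and the closed ball
  with Borel measure give the same integrals; the latter is compact.\<close>

lemma
  fixes f :: "'a::euclidean_space \<Rightarrow> real"
  assumes f: "continuous_on UNIV f" and S: "closed S"
  shows integrable_lebesgue_on_ball: "integrable (lebesgue_on (ball 0 1)) (\<lambda>x. indicator S x * f x)"
    and integral_lebesgue_on_ball: "(LINT x|lebesgue_on (ball 0 1). indicator S x * f x)
      = (LINT x|lborel. indicator (S \<inter> cball 0 1) x * f x)"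
proof -
  have c: "integrable lborel (\<lambda>x. indicator (S \<inter> cball 0 1) x * f x)"
    using borel_integrable_compact[of "S \<inter> cball 0 1" f] S continuous_on_subset[OF f]
    by (simp add: closed_Int_compact)
  then have cL: "integrable lebesgue (\<lambda>x. indicator (S \<inter> cball 0 1) x * f x)"
    by (simp add: integrable_completion)
  have "sphere (0::'a) 1 \<in> null_sets lebesgue"
    using negligible_sphere negligible_iff_null_sets by blast
  then have ae: "AE x in lebesgue. indicator (ball 0 1) x *\<^sub>R (indicator S x * f x) = indicator (S \<inter> cball 0 1) x * f x"
    by (rule AE_I') (auto simp: indicator_def)
  have m: "(\<lambda>x. indicator (ball 0 1) x *\<^sub>R (indicator S x * f x)) \<in> borel_measurable lebesgue"
    using S borel_measurable_continuous_onI[OF f]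
    by (intro measurable_completion) (auto intro!: borel_measurable_times borel_measurable_indicator)
  have "integrable lebesgue (\<lambda>x. indicator (ball 0 1) x *\<^sub>R (indicator S x * f x))"
    using integrable_cong_AE[OF m borel_measurable_integrable[OF cL] ae] cL by simp
  then show "integrable (lebesgue_on (ball 0 1)) (\<lambda>x. indicator S x * f x)"
    by (subst integrable_restrict_space) auto
  have "(LINT x|lebesgue_on (ball 0 1). indicator S x * f x)
      = (LINT x|lebesgue. indicator (ball 0 1) x *\<^sub>R (indicator S x * f x))"
    by (subst integral_restrict_space) auto
  also have "\<dots> = (LINT x|lebesgue. indicator (S \<inter> cball 0 1) x * f x)"
    by (rule integral_cong_AE[OF m borel_measurable_integrable[OF cL] ae])
  also have "\<dots> = (LINT x|lborel. indicator (S \<inter> cball 0 1) x * f x)"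
    by (rule integral_completion) (use borel_measurable_integrable[OF c] in simp)
  finally show "(LINT x|lebesgue_on (ball 0 1). indicator S x * f x)
      = (LINT x|lborel. indicator (S \<inter> cball 0 1) x * f x)" .
qed

text \<open>The condition |x| < 1 is left to the domain of integration, which keeps this set
  closed.\<close>

definition collar :: "real \<Rightarrow> (real^'n) set" where
  "collar d = {x. 1 - 2 * d \<le> x \<bullet> x}"

lemma closed_collar: "closed (collar d)"
  unfolding collar_def by (intro closed_Collect_le continuous_intros)

text \<open>The annulus estimate with its boundary term enlarged to the punctured ball, where it
  becomes a surface integral divided by the dimension.\<close>

lemma integral_collar_le:
  fixes w :: "real^'n \<Rightarrow> real^'m" and d :: real
  assumes w: "\<And>x. (w has_derivative (*v) (W x)) (at x)" and W: "continuous_on UNIV W"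
    and d: "0 < d" "d \<le> 1/4"
  shows "(LINT x|lebesgue_on (ball 0 1). indicator (collar d) x * norm (w x) ^ 4)
    \<le> 8 / CARD('n) * (LINT x|sphere_measure. norm (w x) ^ 4)
      + 2048 * d ^ 4 * (LINT x|lebesgue_on (ball 0 1). indicator (collar d) x * norm (W x) ^ 4)"
proof -
  have wc: "continuous_on UNIV w"
    using w by (meson continuous_on_eq_continuous_at has_derivative_continuous open_UNIV)
  define A where "A = collar d \<inter> cball (0::real^'n) 1"
  have A_eq: "{x::real^'n. 1 - 2 * d \<le> x \<bullet> x \<and> x \<bullet> x \<le> 1} = A"
    by (auto simp: A_def collar_def dot_square_norm power_le_one_iff abs_square_le_1)
  have A: "compact A" unfolding A_def by (intro closed_Int_compact closed_collar compact_cball)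
  have nn: "(\<integral>\<^sup>+x. ennreal (f x) * indicator A x \<partial>lborel) = ennreal (LINT x|lborel. indicator A x * f x)"
    if f: "continuous_on UNIV f" "\<And>x. 0 \<le> f x" for f :: "real^'n \<Rightarrow> real"
  proof -
    have "(\<integral>\<^sup>+x. ennreal (f x) * indicator A x \<partial>lborel) = (\<integral>\<^sup>+x. ennreal (indicator A x * f x) \<partial>lborel)"
      by (intro nn_integral_cong) (auto simp: indicator_def)
    also have "\<dots> = ennreal (LINT x|lborel. indicator A x * f x)"
      using borel_integrable_compact[OF A continuous_on_subset[OF f(1)]] f(2)
      by (intro nn_integral_eq_integral) auto
    finally show ?thesis .
  qed
  have c: "continuous_on UNIV (\<lambda>x. norm (w x) ^ 4)" "continuous_on UNIV (\<lambda>x. norm (W x) ^ 4)"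
    by (intro continuous_on_power continuous_on_norm wc W)+
  let ?s = "\<lambda>x. indicator (ball 0 1 - {0}) x * norm (w (x /\<^sub>R norm x)) ^ 4"
  have s_int: "integrable lborel ?s"
  proof -
    have "bounded ((\<lambda>x. norm (w x) ^ 4) ` sphere 0 1)"
      by (intro compact_imp_bounded compact_continuous_image continuous_on_subset[OF c(1)]) auto
    then obtain b where b: "\<forall>x\<in>sphere 0 1. norm (w x) ^ 4 \<le> b" unfolding bounded_iff by auto
    have [measurable]: "w \<in> borel_measurable borel" by (rule borel_measurable_continuous_onI[OF wc])
    show ?thesis
    proof (rule Bochner_Integration.integrable_bound)
      show "integrable lborel (\<lambda>x. indicator (cball (0::real^'n) 1) x * b)"
        by (intro integrable_mult_left integrable_real_indicator) (use emeasure_compact_finite[OF compact_cball] in auto)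
      have "(\<lambda>x. norm (w (x /\<^sub>R norm x)) ^ 4) \<in> borel_measurable borel" by measurable
      then show "?s \<in> borel_measurable lborel"
        by (auto intro!: borel_measurable_times borel_measurable_indicator)
      show "AE x in lborel. norm (?s x) \<le> norm (indicator (cball (0::real^'n) 1) x * b)"
        by (intro AE_I2) (use b in \<open>auto simp: indicator_def intro: order_trans[OF _ abs_ge_self]\<close>)
    qed
  qed
  have "sphere (0::real^'n) 1 \<in> null_sets lborel"
    using negligible_sphere[of "0::real^'n" 1] by (simp add: negligible_iff_null_sets null_sets_completion_iff)
  then have ae: "AE x in lborel. ennreal (norm (w (x /\<^sub>R norm x)) ^ 4) * indicator A x \<le> ennreal (?s x)"
    by (rule AE_I') (use d in \<open>auto simp: A_def collar_def indicator_def\<close>)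
  have "(\<integral>\<^sup>+x. ennreal (norm (w (x /\<^sub>R norm x)) ^ 4) * indicator A x \<partial>lborel) \<le> (\<integral>\<^sup>+x. ennreal (?s x) \<partial>lborel)"
    by (rule nn_integral_mono_AE[OF ae])
  also have "\<dots> = ennreal (LINT x|lborel. ?s x)"
    by (intro nn_integral_eq_integral s_int) auto
  also have "(LINT x|lborel. ?s x) = (LINT x|sphere_measure. norm (w x) ^ 4) / CARD('n)"
    by (simp add: integral_sphere_measure[OF continuous_on_subset[OF c(1)]])
  finally have s: "(\<integral>\<^sup>+x. ennreal (norm (w (x /\<^sub>R norm x)) ^ 4) * indicator A x \<partial>lborel)
    \<le> ennreal ((LINT x|sphere_measure. norm (w x) ^ 4) / CARD('n))" .
  have "ennreal (LINT x|lborel. indicator A x * norm (w x) ^ 4)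
      \<le> 8 * ennreal ((LINT x|sphere_measure. norm (w x) ^ 4) / CARD('n))
        + ennreal (2048 * d ^ 4) * ennreal (LINT x|lborel. indicator A x * norm (W x) ^ 4)"
    using nn_integral_annulus_le[OF w W d, unfolded A_eq] s
    unfolding nn[OF c(1), simplified] nn[OF c(2), simplified]
    by (meson add_right_mono mult_left_mono order_trans zero_le)
  also have "\<dots> = ennreal (8 / CARD('n) * (LINT x|sphere_measure. norm (w x) ^ 4)
        + 2048 * d ^ 4 * (LINT x|lborel. indicator A x * norm (W x) ^ 4))"
    using d by (simp add: ennreal_plus[symmetric] ennreal_mult[symmetric] ennreal_numeral[symmetric]
         Bochner_Integration.integral_nonneg del: ennreal_plus ennreal_numeral)
  finally have "(LINT x|lborel. indicator A x * norm (w x) ^ 4)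
      \<le> 8 / CARD('n) * (LINT x|sphere_measure. norm (w x) ^ 4)
        + 2048 * d ^ 4 * (LINT x|lborel. indicator A x * norm (W x) ^ 4)"
    using d by (subst (asm) ennreal_le_iff) (auto intro!: add_nonneg_nonneg mult_nonneg_nonneg Bochner_Integration.integral_nonneg)
  then show ?thesis
    by (simp only: integral_lebesgue_on_ball[OF c(1) closed_collar] integral_lebesgue_on_ball[OF c(2) closed_collar] A_def)
qed

subsection \<open>Nonexistence of sphere-valued extensions\<close>

lemma Lp_space_power4:
  assumes "f \<in> Lp_space 4 M"
  shows "f \<in> borel_measurable M" "integrable M (\<lambda>x. norm (f x) ^ 4)"
  using assms by (simp_all add: Lp_space_def)

lemma Lp_norm_power4_tendsto_0:
  assumes "(\<lambda>k. Lp_norm 4 M (f k)) \<longlonglongrightarrow> 0"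
  shows "(\<lambda>k. LINT x|M. norm (f k x) ^ 4) \<longlonglongrightarrow> 0"
proof -
  have "Lp_norm 4 M (f k) ^ 4 = (LINT x|M. norm (f k x) ^ 4)" for k
  proof -
    let ?I = "LINT x|M. norm (f k x) ^ 4"
    have "Lp_norm 4 M (f k) ^ 4 = (?I powr (1/4)) powr 4"
      by (simp add: Lp_norm_def)
    also have "\<dots> = ?I powr 1" by (simp add: powr_powr)
    also have "\<dots> = ?I" by (simp add: Bochner_Integration.integral_nonneg)
    finally show ?thesis .
  qed
  then show ?thesis using tendsto_power[OF assms, of 4] by simp
qed

lemma integrable_norm_power4_diff:
  fixes f g :: "'a \<Rightarrow> 'b::euclidean_space"
  assumes [measurable]: "f \<in> borel_measurable M" "g \<in> borel_measurable M"
    and "integrable M (\<lambda>x. norm (f x) ^ 4)" "integrable M (\<lambda>x. norm (g x) ^ 4)"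
  shows "integrable M (\<lambda>x. norm (f x - g x) ^ 4)"
proof (rule Bochner_Integration.integrable_bound)
  show "integrable M (\<lambda>x. 8 * (norm (f x) ^ 4 + norm (g x) ^ 4))"
    using assms(3,4) by simp
  show "AE x in M. norm (norm (f x - g x) ^ 4) \<le> norm (8 * (norm (f x) ^ 4 + norm (g x) ^ 4))"
  proof (rule AE_I2)
    fix x
    have "norm (f x - g x) ^ 4 \<le> (norm (f x) + norm (g x)) ^ 4" by (intro power_mono norm_triangle_ineq4) simp
    also have "\<dots> \<le> 8 * (norm (f x) ^ 4 + norm (g x) ^ 4)" by (rule power4_add_le)
    finally show "norm (norm (f x - g x) ^ 4) \<le> norm (8 * (norm (f x) ^ 4 + norm (g x) ^ 4))" by simp
  qed
qed measurable

text \<open>Inside, the glued map is \<open>v\<close> itself and the density at \<open>v x\<close>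
  is kept as a factor, since it tends to 0 later; on the collar a plain size bound suffices. The
  constant is \<open>256 * 24 * 64\<close>: density, determinant, four-term convexity.\<close>

lemma cube_density_glue_det_le:
  fixes v g :: "real^4 \<Rightarrow> real^4" and V G :: "real^4 \<Rightarrow> real^4^4"
  assumes d: "d > 0" and x: "norm x < 1"
  shows "cube_density (glue d v x) * det (glue_deriv d v V x) \<le> 393216 *
     (2 * norm (V x - G x) ^ 4 + cube_density (v x) * norm (G x) ^ 4
      + indicator (collar d) x * (16 * norm (mat 1 :: real^4^4) ^ 4 + norm (G x) ^ 4)
      + 16 / d ^ 4 * (indicator (collar d) x * norm (v x - x) ^ 4))"
proof -
  let ?a = "norm (V x - G x)" and ?g = "norm (G x)" and ?m = "norm (mat 1 :: real^4^4)"
    and ?z = "norm (v x - x)" and ?Y = "glue_deriv d v V x"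
  have det: "det A \<le> 24 * norm A ^ 4" for A :: "real^4^4"
    using abs_det_le[of A] by (simp add: fact_numeral)
  have \<rho>: "cube_density y \<le> 256" for y :: "real^4" using cube_density_le[of y] by simp
  show ?thesis
  proof (cases "x \<in> collar d")
    case False
    then have "x \<bullet> x \<le> 1 - 2 * d" by (simp add: collar_def)
    note c = cutoff_inside[OF d this]
    have "norm (V x) ^ 4 \<le> (?a + ?g) ^ 4"
      by (intro power_mono) (use norm_triangle_ineq[of "V x - G x" "G x"] in auto)
    also have "\<dots> \<le> 8 * (?a ^ 4 + ?g ^ 4)" by (rule power4_add_le)
    finally have V: "norm (V x) ^ 4 \<le> 8 * (?a ^ 4 + ?g ^ 4)" .
    have "det (V x) \<le> 192 * (?a ^ 4 + ?g ^ 4)" using det[of "V x"] V by linarith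
    then have "cube_density (v x) * det (V x) \<le> cube_density (v x) * (192 * (?a ^ 4 + ?g ^ 4))"
      by (intro mult_left_mono cube_density_nonneg)
    also have "\<dots> = 192 * (cube_density (v x) * ?a ^ 4) + 192 * (cube_density (v x) * ?g ^ 4)"
      by (simp add: algebra_simps)
    also have "\<dots> \<le> 192 * (256 * ?a ^ 4) + 192 * (cube_density (v x) * ?g ^ 4)"
      by (intro add_right_mono mult_left_mono mult_right_mono \<rho>) auto
    also have "\<dots> \<le> 393216 * (2 * ?a ^ 4 + cube_density (v x) * ?g ^ 4)"
    proof -
      have "192 * (256 * p) + 192 * q \<le> 393216 * (2 * p + q)" if "0 \<le> p" "0 \<le> q" for p q :: real
        using that by simp
      then show ?thesis by (simp add: cube_density_nonneg)
    qed
    finally show ?thesis using False by (simp add: glue_def glue_deriv_def c)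
  next
    case True
    \<comment> \<open>One \<open>mat 1\<close> comes from the identity and one from
      \<open>V x - mat 1\<close>; \<open>2 / d\<close> bounds the slope of the cutoff as a function
      of the point.\<close>
    have "norm ?Y \<le> 2 * ?m + ?a + ?g + 2 / d * ?z"
    proof -
      have "norm ((2 * cutoff_deriv d (x \<bullet> x)) *\<^sub>R outer (v x - x) x) \<le> 2 / d * ?z"
      proof -
        have "\<bar>2 * cutoff_deriv d (x \<bullet> x)\<bar> \<le> 2 / d"
          using abs_cutoff_deriv_le[OF d, of "x \<bullet> x"] by (simp add: abs_mult)
        moreover have "?z * norm x \<le> ?z" using x by (simp add: mult_left_le)
        ultimately have "\<bar>2 * cutoff_deriv d (x \<bullet> x)\<bar> * (?z * norm x) \<le> 2 / d * ?z"
          using d by (intro mult_mono) auto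
        then show ?thesis by (simp add: norm_outer)
      qed
      moreover have "norm (cutoff d (x \<bullet> x) *\<^sub>R (V x - mat 1)) \<le> ?a + ?g + ?m"
      proof -
        have "norm (cutoff d (x \<bullet> x) *\<^sub>R (V x - mat 1)) \<le> norm (V x - mat 1)"
          using cutoff_bounds[of d "x \<bullet> x"] by (simp add: mult_left_le_one_le)
        also have "\<dots> \<le> ?a + ?g + ?m"
          using norm_triangle_ineq[of "V x - G x" "G x"] norm_triangle_ineq4[of "V x" "mat 1"] by simp
        finally show ?thesis .
      qed
      ultimately show ?thesis
        unfolding glue_deriv_def
        using norm_triangle_ineq[of "mat 1 + cutoff d (x \<bullet> x) *\<^sub>R (V x - mat 1)" "(2 * cutoff_deriv d (x \<bullet> x)) *\<^sub>R outer (v x - x) x"]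
          norm_triangle_ineq[of "mat 1" "cutoff d (x \<bullet> x) *\<^sub>R (V x - mat 1)"]
        by linarith
    qed
    then have "norm ?Y ^ 4 \<le> (2 * ?m + ?a + ?g + 2 / d * ?z) ^ 4" by (intro power_mono) auto
    also have "\<dots> \<le> 64 * ((2 * ?m) ^ 4 + ?a ^ 4 + ?g ^ 4 + (2 / d * ?z) ^ 4)" by (rule power4_add4_le)
    also have "\<dots> = 64 * (16 * ?m ^ 4 + ?a ^ 4 + ?g ^ 4 + 16 / d ^ 4 * ?z ^ 4)"
      by (simp add: power_mult_distrib power_divide)
    finally have Y: "norm ?Y ^ 4 \<le> 64 * (16 * ?m ^ 4 + ?a ^ 4 + ?g ^ 4 + 16 / d ^ 4 * ?z ^ 4)" .
    let ?b = "16 * ?m ^ 4 + ?a ^ 4 + ?g ^ 4 + 16 / d ^ 4 * ?z ^ 4"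
    have "det ?Y \<le> 1536 * ?b" using det[of ?Y] Y by linarith
    then have "cube_density (glue d v x) * det ?Y \<le> cube_density (glue d v x) * (1536 * ?b)"
      by (intro mult_left_mono cube_density_nonneg)
    also have "\<dots> \<le> 256 * (1536 * ?b)"
      by (intro mult_right_mono \<rho>) (use d in auto)
    \<comment> \<open>Nonnegative terms are added so that both cases share one right-hand side;
      hence the factor 2 in the statement.\<close>
    also have "\<dots> \<le> 393216 * (?b + (?a ^ 4 + cube_density (v x) * ?g ^ 4))"
      using cube_density_nonneg[of "v x"] by (auto intro!: add_nonneg_nonneg mult_nonneg_nonneg)
    finally show ?thesis using True by (simp add: algebra_simps)
  qed
qed

text \<open>The limits are taken in a fixed order: first \<open>k\<close> with the collar fixed,
  because of the factor \<open>1 / d ^ 4\<close>, then the collar width.\<close>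

lemma no_sphere_valued_extension:
  fixes u :: "real^4 \<Rightarrow> real^4" and G :: "real^4 \<Rightarrow> real^4^4"
    and v :: "nat \<Rightarrow> real^4 \<Rightarrow> real^4" and V :: "nat \<Rightarrow> real^4 \<Rightarrow> real^4^4"
  defines "N \<equiv> lebesgue_on (ball (0::real^4) 1)"
  assumes u: "u \<in> Lp_space 4 N" "AE x in N. norm (u x) = 1"
    and G: "G \<in> Lp_space 4 N"
    and v: "\<And>k x. (v k has_derivative (*v) (V k x)) (at x)"
    and V: "\<And>k. continuous_on UNIV (V k)"
    and vu: "(\<lambda>k. LINT x|N. norm (v k x - u x) ^ 4) \<longlonglongrightarrow> 0"
    and VG: "(\<lambda>k. LINT x|N. norm (V k x - G x) ^ 4) \<longlonglongrightarrow> 0"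
    and vid: "(\<lambda>k. LINT x|sphere_measure. norm (v k x - x) ^ 4) \<longlonglongrightarrow> 0"
  shows False
proof -
  let ?m = "norm (mat 1 :: real^4^4)"
  note [measurable] = Lp_space_power4(1)[OF u(1)] Lp_space_power4(1)[OF G]
  note g4 = Lp_space_power4(2)[OF G]
  have vc: "continuous_on UNIV (v k)" for k
    using v by (meson continuous_on_eq_continuous_at has_derivative_continuous open_UNIV)
  have meas: "f \<in> borel_measurable N" if "continuous_on UNIV f"
    for f :: "real^4 \<Rightarrow> 'c::topological_space"
    unfolding N_def by (intro borel_measurable_lebesgue_on borel_measurable_continuous_onI that)
  note [measurable] = meas[OF vc] meas[OF V] meas[OF continuous_on_cube_density]
  have int: "integrable N f" "integral (cball 0 1) f = (LINT x|N. f x)"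
    if f: "continuous_on UNIV f" for f :: "real^4 \<Rightarrow> real"
  proof -
    show "integrable N f" using integrable_lebesgue_on_ball[OF f closed_UNIV] by (simp add: N_def)
    have "set_integrable lborel (cball 0 1) f"
      unfolding set_integrable_def by (intro borel_integrable_compact continuous_on_subset[OF f]) auto
    from set_borel_integral_eq_integral(2)[OF this] integral_lebesgue_on_ball[OF f closed_UNIV]
    show "integral (cball 0 1) f = (LINT x|N. f x)"
      by (simp add: N_def set_lebesgue_integral_def)
  qed
  have const: "integrable N (\<lambda>_. c)" for c :: real by (rule int) simp
  have [measurable]: "(indicator (collar d) :: real^4 \<Rightarrow> real) \<in> borel_measurable N" for d
    unfolding N_def by (intro borel_measurable_lebesgue_on borel_measurable_indicator borel_closed closed_collar)
  have a_int: "integrable N (\<lambda>x. norm (v k x - u x) ^ 4)" "integrable N (\<lambda>x. norm (V k x - G x) ^ 4)" for k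
    by (intro integrable_norm_power4_diff g4 Lp_space_power4(2)[OF u(1)] int continuous_intros vc V; measurable)+
  \<comment> \<open>Convergence in mean yields almost everywhere convergence along a subsequence, as
    dominated convergence for \<open>\<beta>\<close> requires.\<close>
  obtain r where r: "strict_mono r" "AE x in N. (\<lambda>k. norm (v (r k) x - u x)) \<longlonglongrightarrow> 0"
    using tendsto_L1_AE_subseq[of N "\<lambda>k x. norm (v k x - u x) ^ 4"] a_int(1) vu by auto
  \<comment> \<open>The four error terms: approximation of the gradient, density near the sphere,
    mass on the collar, and boundary mismatch. Only \<open>\<gamma>\<close> depends on
    \<open>d\<close>, and it does not depend on \<open>k\<close>.\<close>
  define \<alpha> where "\<alpha> k = (LINT x|N. norm (V k x - G x) ^ 4)" for k
  define \<beta> where "\<beta> k = (LINT x|N. cube_density (v k x) * norm (G x) ^ 4)" for k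
  define \<gamma> where "\<gamma> d = (LINT x|N. indicator (collar d) x * (16 * ?m ^ 4 + norm (G x) ^ 4))" for d
  define \<sigma> where "\<sigma> k = (LINT x|sphere_measure. norm (v k x - x) ^ 4)" for k
  have \<rho>_le: "norm (cube_density y * norm (G x) ^ 4) \<le> 256 * norm (G x) ^ 4" for y :: "real^4" and x
    using cube_density_le[of y] by (simp add: cube_density_nonneg abs_mult mult_right_mono)
  have [measurable]: "(\<lambda>x. cube_density (v k x)) \<in> borel_measurable N" for k
    by (intro meas continuous_on_compose2[OF continuous_on_cube_density[of UNIV] vc] subset_UNIV)
  have \<beta>_int: "integrable N (\<lambda>x. cube_density (v k x) * norm (G x) ^ 4)" for k
    by (rule Bochner_Integration.integrable_bound[OF integrable_mult_right[OF g4, of 256]])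
       (use \<rho>_le in auto)
  have \<gamma>_int: "integrable N (\<lambda>x. indicator (collar d) x * (16 * ?m ^ 4 + norm (G x) ^ 4))" for d
  proof (rule Bochner_Integration.integrable_bound)
    show "integrable N (\<lambda>x. 16 * ?m ^ 4 + norm (G x) ^ 4)"
      by (intro Bochner_Integration.integrable_add const g4)
    show "(\<lambda>x. indicator (collar d) x * (16 * ?m ^ 4 + norm (G x) ^ 4)) \<in> borel_measurable N" by measurable
  qed (simp add: indicator_def)
  have "(\<lambda>k. \<beta> (r k)) \<longlonglongrightarrow> (LINT x|N. 0)"
    unfolding \<beta>_def
  proof (rule integral_dominated_convergence[where w="\<lambda>x. 256 * norm (G x) ^ 4"])
    show "AE x in N. (\<lambda>k. cube_density (v (r k) x) * norm (G x) ^ 4) \<longlonglongrightarrow> 0"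
      using r(2) u(2)
    proof eventually_elim
      case (elim x)
      then have "(\<lambda>k. v (r k) x) \<longlonglongrightarrow> u x"
        by (simp add: tendsto_norm_zero_iff LIM_zero_iff)
      then have "(\<lambda>k. cube_density (v (r k) x)) \<longlonglongrightarrow> cube_density (u x)"
        by (rule continuous_on_tendsto_compose[OF continuous_on_cube_density[of UNIV]]) simp_all
      then show ?case
        unfolding cube_density_eq_0[OF elim(2)] by (rule tendsto_mult_left_zero)
    qed
    show "AE x in N. norm (cube_density (v (r k) x) * norm (G x) ^ 4) \<le> 256 * norm (G x) ^ 4" for k
      by (intro AE_I2 \<rho>_le)
  qed (use g4 in \<open>auto intro!: integrable_mult_right\<close>)
  then have \<beta>: "(\<lambda>k. \<beta> (r k)) \<longlonglongrightarrow> 0" by simp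
  have \<alpha>: "(\<lambda>k. \<alpha> (r k)) \<longlonglongrightarrow> 0" and \<sigma>: "(\<lambda>k. \<sigma> (r k)) \<longlonglongrightarrow> 0"
    using LIMSEQ_subseq_LIMSEQ[OF VG r(1)] LIMSEQ_subseq_LIMSEQ[OF vid r(1)]
    by (simp_all add: \<alpha>_def[abs_def] \<sigma>_def[abs_def] comp_def)
  let ?c = "integral (cball (0::real^4) 1) cube_density"
  \<comment> \<open>The collar estimate turns \<open>16 / d ^ 4\<close> times the collar integral
    into \<open>32 / d ^ 4 * \<sigma> k\<close> plus \<open>16 * 2048 * 64 = 2097152\<close> times
    \<open>\<alpha> k + \<gamma> d\<close>: the powers of \<open>d\<close> cancel on the gradient
    terms.\<close>
  have key: "?c \<le> 393216 * (2097154 * \<alpha> k + \<beta> k + 2097153 * \<gamma> d + 32 / d ^ 4 * \<sigma> k)"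
    if d: "0 < d" "d \<le> 1/4" for k d
  proof -
    let ?z = "\<lambda>x. indicator (collar d) x * norm (v k x - x) ^ 4"
    let ?f = "\<lambda>x. cube_density (glue d (v k) x) * det (glue_deriv d (v k) (V k) x)"
    have z_int: "integrable N ?z"
      unfolding N_def by (intro integrable_lebesgue_on_ball closed_collar continuous_intros vc)
    have "(glue d (v k) has_derivative (*v) (glue_deriv d (v k) (V k) x)) (at x)" for x
      by (rule has_derivative_glue[OF d(1) v])
    then have gc: "continuous_on UNIV (glue d (v k))"
      by (meson continuous_on_eq_continuous_at has_derivative_continuous open_UNIV)
    have fc: "continuous_on UNIV ?f"
      by (intro continuous_on_mult continuous_on_det continuous_on_glue_deriv d vc V
          continuous_on_compose2[OF continuous_on_cube_density[of UNIV] gc] subset_UNIV)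
    have "?c = (LINT x|N. ?f x)"
      by (simp add: integral_cube_density_glue[OF d(1) v[of k] V[of k]] int(2)[OF fc])
    also have "\<dots> \<le> (LINT x|N. 393216 * (2 * norm (V k x - G x) ^ 4 + cube_density (v k x) * norm (G x) ^ 4
      + indicator (collar d) x * (16 * ?m ^ 4 + norm (G x) ^ 4) + 16 / d ^ 4 * ?z x))"
      by (intro integral_mono int fc integrable_mult_right Bochner_Integration.integrable_add a_int \<beta>_int \<gamma>_int z_int
          cube_density_glue_det_le d) (simp add: N_def)
    also have "\<dots> = 393216 * (2 * \<alpha> k + \<beta> k + \<gamma> d + 16 / d ^ 4 * (LINT x|N. ?z x))"
      using a_int \<beta>_int \<gamma>_int z_int by (simp add: \<alpha>_def \<beta>_def \<gamma>_def)
    finally have 1: "?c \<le> 393216 * (2 * \<alpha> k + \<beta> k + \<gamma> d + 16 / d ^ 4 * (LINT x|N. ?z x))" .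
    let ?W = "\<lambda>x. indicator (collar d) x * norm (V k x - mat 1) ^ 4"
    have "(LINT x|N. ?W x) \<le> (LINT x|N. 64 * norm (V k x - G x) ^ 4 + 64 * (indicator (collar d) x * (16 * ?m ^ 4 + norm (G x) ^ 4)))"
    proof (intro integral_mono Bochner_Integration.integrable_add integrable_mult_right a_int \<gamma>_int)
      show "integrable N ?W"
        unfolding N_def by (intro integrable_lebesgue_on_ball closed_collar continuous_intros V)
      fix x
      \<comment> \<open>The summand 0 fits the three terms to the four-term inequality.\<close>
      have "norm (V k x - mat 1) \<le> norm (V k x - G x) + norm (G x) + ?m + 0"
        using norm_triangle_ineq[of "V k x - G x" "G x"] norm_triangle_ineq4[of "V k x" "mat 1"] by simp
      then have "norm (V k x - mat 1) ^ 4 \<le> (norm (V k x - G x) + norm (G x) + ?m + 0) ^ 4"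
        by (intro power_mono) auto
      also have "\<dots> \<le> 64 * (norm (V k x - G x) ^ 4 + norm (G x) ^ 4 + ?m ^ 4 + 0 ^ 4)" by (rule power4_add4_le)
      also have "\<dots> \<le> 64 * norm (V k x - G x) ^ 4 + 64 * (16 * ?m ^ 4 + norm (G x) ^ 4)" by simp
      finally show "?W x \<le> 64 * norm (V k x - G x) ^ 4 + 64 * (indicator (collar d) x * (16 * ?m ^ 4 + norm (G x) ^ 4))"
        by (auto simp: indicator_def)
    qed
    also have "\<dots> = 64 * \<alpha> k + 64 * \<gamma> d" using a_int \<gamma>_int by (simp add: \<alpha>_def \<gamma>_def)
    finally have 2: "(LINT x|N. ?W x) \<le> 64 * \<alpha> k + 64 * \<gamma> d" .
    have wd: "((\<lambda>x. v k x - x) has_derivative (*v) (V k x - mat 1)) (at x)" for x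
      by (rule has_derivative_eq_rhs[OF has_derivative_diff[OF v has_derivative_ident]])
         (simp add: fun_eq_iff matrix_vector_mult_diff_rdistrib)
    have "(LINT x|N. ?z x) \<le> 2 * \<sigma> k + 2048 * d ^ 4 * (LINT x|N. ?W x)"
      using integral_collar_le[OF wd continuous_on_diff[OF V[of k] continuous_on_const] d]
      by (simp add: \<sigma>_def N_def)
    also have "\<dots> \<le> 2 * \<sigma> k + 2048 * d ^ 4 * (64 * \<alpha> k + 64 * \<gamma> d)"
      by (intro add_left_mono mult_left_mono 2) simp
    finally have "16 / d ^ 4 * (LINT x|N. ?z x) \<le> 16 / d ^ 4 * (2 * \<sigma> k + 2048 * d ^ 4 * (64 * \<alpha> k + 64 * \<gamma> d))"
      by (intro mult_left_mono) simp_all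
    also have "\<dots> = 32 / d ^ 4 * \<sigma> k + 2097152 * (\<alpha> k + \<gamma> d)"
      using d by (simp add: field_simps)
    finally have "2 * \<alpha> k + \<beta> k + \<gamma> d + 16 / d ^ 4 * (LINT x|N. ?z x)
        \<le> 2097154 * \<alpha> k + \<beta> k + 2097153 * \<gamma> d + 32 / d ^ 4 * \<sigma> k"
      by (simp add: algebra_simps)
    then show ?thesis by (intro order_trans[OF 1] mult_left_mono) simp_all
  qed
  have c\<gamma>: "?c \<le> 393216 * (2097153 * \<gamma> d)" if d: "0 < d" "d \<le> 1/4" for d
  proof -
    have "(\<lambda>k. 393216 * (2097154 * \<alpha> (r k) + \<beta> (r k) + 2097153 * \<gamma> d + 32 / d ^ 4 * \<sigma> (r k)))
        \<longlonglongrightarrow> 393216 * (2097154 * 0 + 0 + 2097153 * \<gamma> d + 32 / d ^ 4 * 0)"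
      by (intro tendsto_intros \<alpha> \<beta> \<sigma>)
    then have "(\<lambda>k. 393216 * (2097154 * \<alpha> (r k) + \<beta> (r k) + 2097153 * \<gamma> d + 32 / d ^ 4 * \<sigma> (r k)))
        \<longlonglongrightarrow> 393216 * (2097153 * \<gamma> d)" by simp
    then show ?thesis by (rule LIMSEQ_le_const) (use key[OF d] in blast)
  qed
  \<comment> \<open>The offset 3 gives \<open>t j = 1 / (j + 4)\<close>, so every width respects the
    bound 1/4.\<close>
  define t where "t j = inverse (real (Suc (j + 3)))" for j
  have t0: "t \<longlonglongrightarrow> 0" unfolding t_def[abs_def] using LIMSEQ_ignore_initial_segment[OF LIMSEQ_inverse_real_of_nat, of 3] .
  \<comment> \<open>Each point of the open ball eventually leaves the shrinking collars.\<close>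
  have "(\<lambda>j. \<gamma> (t j)) \<longlonglongrightarrow> (LINT x|N. 0)"
    unfolding \<gamma>_def
  proof (rule integral_dominated_convergence[where w="\<lambda>x. 16 * ?m ^ 4 + norm (G x) ^ 4"])
    show "AE x in N. (\<lambda>j. indicator (collar (t j)) x * (16 * ?m ^ 4 + norm (G x) ^ 4)) \<longlonglongrightarrow> 0"
    proof (rule AE_I2)
      fix x assume "x \<in> space N"
      then have "x \<bullet> x < 1" by (simp add: N_def dot_square_norm power_less_one_iff)
      moreover have "(\<lambda>j. 1 - 2 * t j) \<longlonglongrightarrow> 1 - 2 * 0" by (intro tendsto_intros t0)
      ultimately have "eventually (\<lambda>j. x \<bullet> x < 1 - 2 * t j) sequentially"
        by (simp add: order_tendstoD(1))
      then have "eventually (\<lambda>j. indicator (collar (t j)) x * (16 * ?m ^ 4 + norm (G x) ^ 4) = 0) sequentially"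
        by eventually_elim (simp add: collar_def)
      then show "(\<lambda>j. indicator (collar (t j)) x * (16 * ?m ^ 4 + norm (G x) ^ 4)) \<longlonglongrightarrow> 0"
        by (rule tendsto_eventually)
    qed
    show "integrable N (\<lambda>x. 16 * ?m ^ 4 + norm (G x) ^ 4)"
      by (intro Bochner_Integration.integrable_add const g4)
    show "(\<lambda>x. indicator (collar (t j)) x * (16 * ?m ^ 4 + norm (G x) ^ 4)) \<in> borel_measurable N" for j
      by (rule borel_measurable_integrable[OF \<gamma>_int])
  qed (auto simp: indicator_def)
  then have lim: "(\<lambda>j. 393216 * (2097153 * \<gamma> (t j))) \<longlonglongrightarrow> 393216 * (2097153 * 0)"
    by (intro tendsto_intros) simp
  have "?c \<le> 393216 * (2097153 * \<gamma> (t j))" for j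
    by (rule c\<gamma>) (auto simp: t_def field_simps)
  then have "?c \<le> 393216 * (2097153 * 0)" by (intro LIMSEQ_le_const[OF lim]) blast
  then show False using integral_cube_density_pos[where 'n=4] by simp
qed

section \<open>The identity as counterexample\<close>

theorem proposition2p8:
  shows "\<not> (\<exists>f :: real \<Rightarrow> real. (\<forall>t \<ge> 0. f t \<ge> 0) \<and>
    (\<forall>\<phi> :: real^4 \<Rightarrow> real^4. \<phi> \<in> sobolev_sphere_sphere 3 \<longrightarrow>
      (\<exists>u :: real^4 \<Rightarrow> real^4. u \<in> sobolev_ball_sphere 4 \<and> has_trace 4 u \<phi> \<and>
        Lp_norm 4 (lebesgue_on (ball 0 1)) (weak_gradient 4 (ball 0 1) u)
          \<le> f (Lp_norm 3 sphere_measure (sphere_gradient 3 \<phi>)))))"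
proof
  assume "\<exists>f :: real \<Rightarrow> real. (\<forall>t \<ge> 0. f t \<ge> 0) \<and>
    (\<forall>\<phi> :: real^4 \<Rightarrow> real^4. \<phi> \<in> sobolev_sphere_sphere 3 \<longrightarrow>
      (\<exists>u :: real^4 \<Rightarrow> real^4. u \<in> sobolev_ball_sphere 4 \<and> has_trace 4 u \<phi> \<and>
        Lp_norm 4 (lebesgue_on (ball 0 1)) (weak_gradient 4 (ball 0 1) u)
          \<le> f (Lp_norm 3 sphere_measure (sphere_gradient 3 \<phi>))))"
  then have "\<exists>u :: real^4 \<Rightarrow> real^4. u \<in> sobolev_ball_sphere 4 \<and> has_trace 4 u \<phi>"
    if "\<phi> \<in> sobolev_sphere_sphere 3" for \<phi> :: "real^4 \<Rightarrow> real^4"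
    using that by blast
  from this[OF identity_sobolev_sphere_sphere]
  obtain u :: "real^4 \<Rightarrow> real^4" where u: "u \<in> sobolev_ball_sphere 4" "has_trace 4 u (\<lambda>x. x)"
    by auto
  let ?N = "lebesgue_on (ball (0::real^4) 1)" and ?G = "weak_gradient 4 (ball 0 1) u"
  have us: "u \<in> Lp_space 4 ?N" "AE x in ?N. norm (u x) = 1"
    using u(1) by (auto simp: sobolev_ball_sphere_def sobolev_def)
  have "\<exists>G. G \<in> Lp_space 4 ?N \<and> is_weak_gradient (ball 0 1) u G"
    using u(1) by (auto simp: sobolev_ball_sphere_def sobolev_def)
  \<comment> \<open>\<open>weak_gradient\<close> is a choice, so its integrability comes from the
    existence of some weak gradient.\<close>
  from someI_ex[OF this] have G: "?G \<in> Lp_space 4 ?N"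
    unfolding weak_gradient_def by (rule conjunct1)
  obtain v :: "nat \<Rightarrow> real^4 \<Rightarrow> real^4" where v: "\<And>k. smooth (v k)"
      "(\<lambda>k. Lp_norm 4 ?N (\<lambda>x. v k x - u x)) \<longlonglongrightarrow> 0"
      "(\<lambda>k. Lp_norm 4 ?N (\<lambda>x. jacobian (v k) (at x) - ?G x)) \<longlonglongrightarrow> 0"
      "(\<lambda>k. Lp_norm 4 sphere_measure (\<lambda>x. v k x - x)) \<longlonglongrightarrow> 0"
    using u(2) unfolding has_trace_def by auto
  note v' = smooth_has_derivative[OF v(1)]
  have J: "(v k has_derivative (*v) (jacobian (v k) (at x))) (at x)" for k x
    by (rule jacobian_works[THEN iffD1, OF differentiableI[OF v'(1)]])
  \<comment> \<open>The columns of the Jacobian are directional derivatives, which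
    \<open>smooth\<close> makes continuous one direction at a time.\<close>
  have Jc: "continuous_on UNIV (\<lambda>x. jacobian (v k) (at x))" for k
    unfolding jacobian_def matrix_def by (intro continuous_on_vec_lambda continuous_on_component v'(2))
  show False
    by (rule no_sphere_valued_extension[OF us G J Jc Lp_norm_power4_tendsto_0[OF v(2)]
          Lp_norm_power4_tendsto_0[OF v(3)] Lp_norm_power4_tendsto_0[OF v(4)]])
qed

end
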